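(* Let $\ell>0$. Assume that $\mathbf M,\mathbf C\in C^1([0,\ell];\mathbb R^{6\times6})$ (with symmetric positive definite values), $R\in C^2([0,\ell];\mathrm{SO}(3))$, $(\mathbf p^0,\mathbf R^0)\in C^2([0,\ell];\mathbb R^3\times\mathrm{SO}(3))$, $\mathbf p^1,w^0\in C^1([0,\ell];\mathbb R^3)$ and $(f^{\mathbf p},f^{\mathbf R})\in\mathbb R^3\times\mathrm{SO}(3)$ are such that $(f^{\mathbf p},f^{\mathbf R})=(\mathbf p^0,\mathbf R^0)(0)$. Let $$y^0=\begin{bmatrix}v^0\\ z^0\end{bmatrix},\quad v^0=\begin{bmatrix}(\mathbf R^0)^\intercal\mathbf p^1\\ (\mathbf R^0)^\intercal w^0\end{bmatrix},\quad z^0=\mathbf C^{-1}\begin{bmatrix}(\mathbf R^0)^\intercal\frac{\mathrm d}{\mathrm dx}\mathbf p^0-e_1\\ \mathrm{vec}\big((\mathbf R^0)^\intercal\frac{\mathrm d}{\mathrm dx}\mathbf R^0\big)-\Upsilon_c\end{bmatrix}.$$ Then, if there exists a unique solution $y\in C^1([0,\ell]\times[0,T];\mathbb R^{12})$ to the intrinsic system (I) with initial data $y^0$ (for some $T>0$), there exists a unique solution $(\mathbf p,\mathbf R)\in C^2([0,\ell]\times[0,T];\mathbb R^3\times\mathrm{SO}(3))$ to the system (G) with initial data $(\mathbf p^0,\mathbf R^0,\mathbf p^1,w^0)$ and boundary data $(f^{\mathbf p},f^{\mathbf R})$, and $y=\mathcal T(\mathbf p,\mathbf R)$. The systems (I),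 (G) and the map $\mathcal T$ are given in the context.
   Context: For $u,\zeta\in\mathbb R^3$, $\widehat u\,\zeta=u\times\zeta$ ($\widehat u$ skew-symmetric) and $\mathrm{vec}(\widehat u)=u$. $e_1=(1,0,0)^\intercal$; $\Upsilon_c=\mathrm{vec}(R^\intercal\frac{\mathrm d}{\mathrm dx}R)$. The feedback matrix $K$ is either a symmetric positive definite $6\times6$ matrix (velocity feedback) or $0$ (free end). Transformation: $\mathcal T(\mathbf p,\mathbf R)=(v^\intercal,z^\intercal)^\intercal$ with $$v=\begin{bmatrix}\mathbf R^\intercal\partial_t\mathbf p\\ \mathrm{vec}(\mathbf R^\intercal\partial_t\mathbf R)\end{bmatrix},\quad z=\mathbf C^{-1}\begin{bmatrix}\mathbf R^\intercal\partial_x\mathbf p-e_1\\ \mathrm{vec}(\mathbf R^\intercal\partial_x\mathbf R)-\Upsilon_c\end{bmatrix}.\qquad( * )$$ System (G): unknown $(\mathbf p,\mathbf R)$ with values in $\mathbb R^3\times\mathrm{SO}(3)$. With $v,z$ as in $( * )$, $W=\mathrm{vec}(\mathbf R^\intercal\partial_t\mathbf R)$, $\begin{bmatrix}\phi\\ \psi\end{bmatrix}=\mathrm{diag}(\mathbf R,\mathbf R)z$ and $\begin{bmatrix}a\\ b\end{bmatrix}=\mathrm{diag}(\mathbf R,\mathbf R)\mathbf Mv$ ($a,b,\phi,\psi$ in $\mathbb R^3$): - $\partial_ta=\partial_x\phi$ and $(\partial_t\mathbf p)\times a+\partial_tb=(\partial_x\mathbf p)\times\phi+\partial_x\psi$ in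 $(0,\ell)\times(0,T)$; - $(\mathbf p,\mathbf R)(0,t)=(f^{\mathbf p},f^{\mathbf R})$, $t\in(0,T)$; - $\begin{bmatrix}\phi\\ \psi\end{bmatrix}(\ell,t)=-\mathrm{diag}(\mathbf R(\ell,t),\mathbf R(\ell,t))Kv(\ell,t)$, $t\in(0,T)$; - $(\mathbf p,\mathbf R)(x,0)=(\mathbf p^0,\mathbf R^0)(x)$ and $(\partial_t\mathbf p,\mathbf RW)(x,0)=(\mathbf p^1,w^0)(x)$, $x\in(0,\ell)$. System (I): unknown $y=(v^\intercal,z^\intercal)^\intercal$, $v,z\in\mathbb R^6$: - $\partial_ty+A(x)\partial_xy+\overline B(x)y=\overline g(x,y)$ in $(0,\ell)\times(0,T)$; - $v(0,t)=0$ and $z(\ell,t)=-Kv(\ell,t)$, $t\in(0,T)$; - $y(x,0)=y^0(x)$, $x\in(0,\ell)$, where, with $\mathbf E=\begin{bmatrix}\widehat\Upsilon_c&0\\ \widehat e_1&\widehat\Upsilon_c\end{bmatrix}$ and $Q^{\mathcal P}=\mathrm{diag}(\mathbf M,\mathbf C)$, $$A=-(Q^{\mathcal P})^{-1}\begin{bmatrix}0&\mathbf I_6\\ \mathbf I_6&0\end{bmatrix},\quad\overline B=(Q^{\mathcal P})^{-1}\begin{bmatrix}0&-\mathbf E\\ \mathbf E^\intercal&0\end{bmatrix},\quad\overline g(x,u)=Q^{\mathcal P}(x)^{-1}\mathcal G(u)Q^{\mathcal P}(x)u,$$ and for $u=(u_1^\intercal,u_2^\intercal,u_3^\intercal,u_4^\intercal)^\intercal$,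 $u_j\in\mathbb R^3$, $$\mathcal G(u)=-\begin{bmatrix}\widehat u_2&0&0&\widehat u_3\\ \widehat u_1&\widehat u_2&\widehat u_3&\widehat u_4\\ 0&0&\widehat u_2&\widehat u_1\\ 0&0&0&\widehat u_2\end{bmatrix}.$$ *)

theory Defs
  imports "HOL-Analysis.Analysis"
begin

section \<open>Block vectors and matrices\<close>

text \<open>
  Block structure is carried by sum types as index types: vectors of dimension 6 and 12
  are indexed by \<open>3 + 3\<close> and \<open>(3 + 3) + (3 + 3)\<close>, the left summand being the upper block.
\<close>

type_synonym real6 = "real ^ (3 + 3)"
type_synonym real12 = "real ^ ((3 + 3) + (3 + 3))"
type_synonym mat6 = "real ^ (3 + 3) ^ (3 + 3)"
type_synonym mat12 = "real ^ ((3 + 3) + (3 + 3)) ^ ((3 + 3) + (3 + 3))"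

definition stack :: "'a ^ 'm::finite \<Rightarrow> 'a ^ 'n::finite \<Rightarrow> 'a ^ ('m + 'n)" where
  "stack a b = (\<chi> i. case i of Inl j \<Rightarrow> a $ j | Inr j \<Rightarrow> b $ j)"

definition upper :: "'a ^ ('m::finite + 'n::finite) \<Rightarrow> 'a ^ 'm" where
  "upper u = (\<chi> i. u $ Inl i)"

definition lower :: "'a ^ ('m::finite + 'n::finite) \<Rightarrow> 'a ^ 'n" where
  "lower u = (\<chi> i. u $ Inr i)"

definition block_mat ::
  "'a ^ 'n::finite ^ 'm::finite \<Rightarrow> 'a ^ 'q::finite ^ 'm \<Rightarrow> 'a ^ 'n ^ 'p::finite \<Rightarrow> 'a ^ 'q ^ 'p \<Rightarrow> 'a ^ ('n + 'q) ^ ('m + 'p)" where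
  "block_mat A B C D =
     (\<chi> i. case i of Inl k \<Rightarrow> stack (A $ k) (B $ k) | Inr k \<Rightarrow> stack (C $ k) (D $ k))"

definition block_diag :: "'a::zero ^ 'n::finite ^ 'm::finite \<Rightarrow> 'a ^ 'q::finite ^ 'p::finite \<Rightarrow> 'a ^ ('n + 'q) ^ ('m + 'p)" where
  "block_diag A D = block_mat A 0 0 D"

lemma upper_stack [simp]: "upper (stack a b) = a"
  and lower_stack [simp]: "lower (stack a b) = b"
  by (simp_all add: upper_def lower_def stack_def vec_eq_iff)

lemma stack_upper_lower [simp]: "stack (upper u) (lower u) = u"
  by (auto simp: upper_def lower_def stack_def vec_eq_iff split: sum.splits)

lemma block_mat_mult_stack:
  fixes A :: "'a::semiring_1 ^ 'n::finite ^ 'm::finite" and D :: "'a ^ 'q::finite ^ 'p::finite"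
  shows "block_mat A B C D *v stack a b = stack (A *v a + B *v b) (C *v a + D *v b)"
proof -
  have sum_UNIV_Plus: "(\<Sum>j\<in>UNIV. g j) = (\<Sum>j\<in>UNIV. g (Inl j)) + (\<Sum>j\<in>UNIV. g (Inr j))"
    for g :: "'n + 'q \<Rightarrow> 'a"
    using sum.Plus[of "UNIV :: 'n set" "UNIV :: 'q set" g] by (simp add: comp_def)
  show ?thesis
    by (auto simp: vec_eq_iff matrix_vector_mult_def block_mat_def stack_def sum_UNIV_Plus
             split: sum.splits)
qed

definition sym_pos_def :: "real ^ 'n::finite ^ 'n \<Rightarrow> bool" where
  "sym_pos_def A \<longleftrightarrow> transpose A = A \<and> (\<forall>u. u \<noteq> 0 \<longrightarrow> 0 < u \<bullet> (A *v u))"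


section \<open>Skew-symmetric matrices\<close>

definition hat :: "real ^ 3 \<Rightarrow> real ^ 3 ^ 3" where
  "hat u = matrix (cross3 u)"

text \<open>The inverse of \<open>hat\<close>; only meaningful on skew-symmetric matrices.\<close>

definition axial :: "real ^ 3 ^ 3 \<Rightarrow> real ^ 3" where
  "axial A = vector [A $ 3 $ 2, A $ 1 $ 3, A $ 2 $ 1]"

lemma hat_mult_vec: "hat u *v \<zeta> = cross3 u \<zeta>"
  using bilinear_cross unfolding hat_def bilinear_def by (simp add: matrix_works)

lemma axial_hat: "axial (hat u) = u"
  by (simp add: axial_def hat_def matrix_def cross3_def axis_def vec_eq_iff forall_3)

lemma hat_axial:
  assumes "transpose A = - A"
  shows "hat (axial A) = A"
proof -
  have skew: "A $ i $ j = - A $ j $ i" for i j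
    using arg_cong[OF assms, of "\<lambda>B. B $ j $ i"] by (simp add: transpose_def)
  have "A $ 1 $ 1 = 0" "A $ 2 $ 2 = 0" "A $ 3 $ 3 = 0"
    using skew[of 1 1] skew[of 2 2] skew[of 3 3] by linarith+
  then show ?thesis
    using skew[of 1 2] skew[of 2 3] skew[of 3 1]
    unfolding hat_def axial_def matrix_def cross3_def axis_def vec_eq_iff forall_3 by simp
qed

definition e1 :: "real ^ 3" where
  "e1 = vector [1, 0, 0]"


section \<open>Functions of class $C^k$ on a compact interval or rectangle\<close>

text \<open>
  Derivatives are taken within the closed interval, hence are one-sided at its end points.
\<close>

definition Dseg :: "real \<Rightarrow> (real \<Rightarrow> 'a::real_normed_vector) \<Rightarrow> real \<Rightarrow> 'a" where
  "Dseg l f x = vector_derivative f (at x within {0..l})"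

primrec Ck_seg :: "nat \<Rightarrow> real \<Rightarrow> (real \<Rightarrow> 'a::real_normed_vector) \<Rightarrow> bool" where
  "Ck_seg 0 l f \<longleftrightarrow> continuous_on {0..l} f"
| "Ck_seg (Suc k) l f \<longleftrightarrow>
     continuous_on {0..l} f \<and> f differentiable_on {0..l} \<and> Ck_seg k l (Dseg l f)"

definition Dx :: "real \<Rightarrow> (real \<Rightarrow> real \<Rightarrow> 'a::real_normed_vector) \<Rightarrow> real \<Rightarrow> real \<Rightarrow> 'a" where
  "Dx l f x t = vector_derivative (\<lambda>\<xi>. f \<xi> t) (at x within {0..l})"

definition Dt :: "real \<Rightarrow> (real \<Rightarrow> real \<Rightarrow> 'a::real_normed_vector) \<Rightarrow> real \<Rightarrow> real \<Rightarrow> 'a" where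
  "Dt T f x t = vector_derivative (\<lambda>\<tau>. f x \<tau>) (at t within {0..T})"

primrec Ck_rect ::
  "nat \<Rightarrow> real \<Rightarrow> real \<Rightarrow> (real \<Rightarrow> real \<Rightarrow> 'a::real_normed_vector) \<Rightarrow> bool" where
  "Ck_rect 0 l T f \<longleftrightarrow> continuous_on ({0..l} \<times> {0..T}) (\<lambda>(x, t). f x t)"
| "Ck_rect (Suc k) l T f \<longleftrightarrow>
     continuous_on ({0..l} \<times> {0..T}) (\<lambda>(x, t). f x t) \<and>
     (\<forall>t\<in>{0..T}. (\<lambda>x. f x t) differentiable_on {0..l}) \<and>
     (\<forall>x\<in>{0..l}. (\<lambda>t. f x t) differentiable_on {0..T}) \<and>
     Ck_rect k l T (Dx l f) \<and> Ck_rect k l T (Dt T f)"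


section \<open>The geometrically exact beam and its intrinsic formulation\<close>

text \<open>
  Throughout, \<open>M\<close> and \<open>C\<close> are the mass and flexibility matrices, \<open>R\<close> is the rotation field of
  the reference configuration, \<open>p\<close> and \<open>Rot\<close> are position and rotation of the deformed beam,
  and \<open>l\<close>, \<open>T\<close> are the sides of the rectangle on which everything is considered.
\<close>

definition curvature :: "real \<Rightarrow> (real \<Rightarrow> real ^ 3 ^ 3) \<Rightarrow> real \<Rightarrow> real ^ 3" where
  "curvature l R x = axial (transpose (R x) ** Dseg l R x)"

subsection \<open>The transformation\<close>

definition velocity ::
  "real \<Rightarrow> (real \<Rightarrow> real \<Rightarrow> real ^ 3) \<Rightarrow> (real \<Rightarrow> real \<Rightarrow> real ^ 3 ^ 3) \<Rightarrow> real \<Rightarrow> real \<Rightarrow> real6" where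
  "velocity T p Rot x t =
     stack (transpose (Rot x t) *v Dt T p x t)
           (axial (transpose (Rot x t) ** Dt T Rot x t))"

definition stress ::
  "real \<Rightarrow> (real \<Rightarrow> mat6) \<Rightarrow> (real \<Rightarrow> real ^ 3 ^ 3) \<Rightarrow>
   (real \<Rightarrow> real \<Rightarrow> real ^ 3) \<Rightarrow> (real \<Rightarrow> real \<Rightarrow> real ^ 3 ^ 3) \<Rightarrow> real \<Rightarrow> real \<Rightarrow> real6" where
  "stress l C R p Rot x t =
     matrix_inv (C x) *v
       stack (transpose (Rot x t) *v Dx l p x t - e1)
             (axial (transpose (Rot x t) ** Dx l Rot x t) - curvature l R x)"

definition transf ::
  "real \<Rightarrow> real \<Rightarrow> (real \<Rightarrow> mat6) \<Rightarrow> (real \<Rightarrow> real ^ 3 ^ 3) \<Rightarrow>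
   (real \<Rightarrow> real \<Rightarrow> real ^ 3) \<Rightarrow> (real \<Rightarrow> real \<Rightarrow> real ^ 3 ^ 3) \<Rightarrow> real \<Rightarrow> real \<Rightarrow> real12" where
  "transf l T C R p Rot x t = stack (velocity T p Rot x t) (stress l C R p Rot x t)"

subsection \<open>The geometrically exact beam system\<close>

definition solves_GEB ::
  "real \<Rightarrow> real \<Rightarrow> (real \<Rightarrow> mat6) \<Rightarrow> (real \<Rightarrow> mat6) \<Rightarrow> (real \<Rightarrow> real ^ 3 ^ 3) \<Rightarrow> mat6 \<Rightarrow>
   real ^ 3 \<Rightarrow> real ^ 3 ^ 3 \<Rightarrow>
   (real \<Rightarrow> real ^ 3) \<Rightarrow> (real \<Rightarrow> real ^ 3 ^ 3) \<Rightarrow> (real \<Rightarrow> real ^ 3) \<Rightarrow> (real \<Rightarrow> real ^ 3) \<Rightarrow>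
   (real \<Rightarrow> real \<Rightarrow> real ^ 3) \<Rightarrow> (real \<Rightarrow> real \<Rightarrow> real ^ 3 ^ 3) \<Rightarrow> bool" where
  "solves_GEB l T M C R K fp fR p0 R0 p1 w0 p Rot \<longleftrightarrow>
    (let v = velocity T p Rot;
         z = stress l C R p Rot;
         W = (\<lambda>x t. axial (transpose (Rot x t) ** Dt T Rot x t));
         a = (\<lambda>x t. upper (block_diag (Rot x t) (Rot x t) *v (M x *v v x t)));
         b = (\<lambda>x t. lower (block_diag (Rot x t) (Rot x t) *v (M x *v v x t)));
         \<phi> = (\<lambda>x t. upper (block_diag (Rot x t) (Rot x t) *v z x t));
         \<psi> = (\<lambda>x t. lower (block_diag (Rot x t) (Rot x t) *v z x t))
     in
      Ck_rect 2 l T p \<and> Ck_rect 2 l T Rot \<and>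
      (\<forall>x\<in>{0..l}. \<forall>t\<in>{0..T}. rotation_matrix (Rot x t)) \<and>
      (\<forall>x\<in>{0<..<l}. \<forall>t\<in>{0<..<T}.
         Dt T a x t = Dx l \<phi> x t \<and>
         cross3 (Dt T p x t) (a x t) + Dt T b x t =
           cross3 (Dx l p x t) (\<phi> x t) + Dx l \<psi> x t) \<and>
      (\<forall>t\<in>{0<..<T}. p 0 t = fp \<and> Rot 0 t = fR) \<and>
      (\<forall>t\<in>{0<..<T}.
         stack (\<phi> l t) (\<psi> l t) = - (block_diag (Rot l t) (Rot l t) *v (K *v v l t))) \<and>
      (\<forall>x\<in>{0<..<l}. p x 0 = p0 x \<and> Rot x 0 = R0 x \<and>
         Dt T p x 0 = p1 x \<and> Rot x 0 *v W x 0 = w0 x))"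

subsection \<open>The intrinsic system\<close>

definition QP :: "(real \<Rightarrow> mat6) \<Rightarrow> (real \<Rightarrow> mat6) \<Rightarrow> real \<Rightarrow> mat12" where
  "QP M C x = block_diag (M x) (C x)"

definition Emat :: "real \<Rightarrow> (real \<Rightarrow> real ^ 3 ^ 3) \<Rightarrow> real \<Rightarrow> mat6" where
  "Emat l R x = block_mat (hat (curvature l R x)) 0 (hat e1) (hat (curvature l R x))"

definition Amat :: "(real \<Rightarrow> mat6) \<Rightarrow> (real \<Rightarrow> mat6) \<Rightarrow> real \<Rightarrow> mat12" where
  "Amat M C x = - (matrix_inv (QP M C x) ** block_mat 0 (mat 1) (mat 1) 0)"

definition Bmat ::
  "real \<Rightarrow> (real \<Rightarrow> mat6) \<Rightarrow> (real \<Rightarrow> mat6) \<Rightarrow> (real \<Rightarrow> real ^ 3 ^ 3) \<Rightarrow> real \<Rightarrow> mat12" where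
  "Bmat l M C R x =
     matrix_inv (QP M C x) ** block_mat 0 (- Emat l R x) (transpose (Emat l R x)) 0"

definition Gmat :: "real12 \<Rightarrow> mat12" where
  "Gmat u =
    (let h1 = hat (upper (upper u)); h2 = hat (lower (upper u));
         h3 = hat (upper (lower u)); h4 = hat (lower (lower u))
     in - block_mat (block_mat h2 0
                               h1 h2) (block_mat 0 h3
                                                 h3 h4)
                    0                 (block_mat h2 h1
                                                 0 h2))"

definition gbar :: "(real \<Rightarrow> mat6) \<Rightarrow> (real \<Rightarrow> mat6) \<Rightarrow> real \<Rightarrow> real12 \<Rightarrow> real12" where
  "gbar M C x u = matrix_inv (QP M C x) *v (Gmat u *v (QP M C x *v u))"

definition solves_IGEB ::
  "real \<Rightarrow> real \<Rightarrow> (real \<Rightarrow> mat6) \<Rightarrow> (real \<Rightarrow> mat6) \<Rightarrow> (real \<Rightarrow> real ^ 3 ^ 3) \<Rightarrow> mat6 \<Rightarrow>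
   (real \<Rightarrow> real12) \<Rightarrow> (real \<Rightarrow> real \<Rightarrow> real12) \<Rightarrow> bool" where
  "solves_IGEB l T M C R K y0 y \<longleftrightarrow>
     Ck_rect 1 l T y \<and>
     (\<forall>x\<in>{0<..<l}. \<forall>t\<in>{0<..<T}.
        Dt T y x t + Amat M C x *v Dx l y x t + Bmat l M C R x *v y x t = gbar M C x (y x t)) \<and>
     (\<forall>t\<in>{0<..<T}. upper (y 0 t) = 0 \<and> lower (y l t) = - (K *v upper (y l t))) \<and>
     (\<forall>x\<in>{0<..<l}. y x 0 = y0 x)"

definition y_init ::
  "real \<Rightarrow> (real \<Rightarrow> mat6) \<Rightarrow> (real \<Rightarrow> real ^ 3 ^ 3) \<Rightarrow>
   (real \<Rightarrow> real ^ 3) \<Rightarrow> (real \<Rightarrow> real ^ 3 ^ 3) \<Rightarrow> (real \<Rightarrow> real ^ 3) \<Rightarrow> (real \<Rightarrow> real ^ 3) \<Rightarrow>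
   real \<Rightarrow> real12" where
  "y_init l C R p0 R0 p1 w0 x =
     stack (stack (transpose (R0 x) *v p1 x) (transpose (R0 x) *v w0 x))
           (matrix_inv (C x) *v
              stack (transpose (R0 x) *v Dseg l p0 x - e1)
                    (axial (transpose (R0 x) ** Dseg l R0 x) - curvature l R x))"

end

theory Submission
  imports Defs
begin

text \<open>
  Read off from \<open>y\<close> the strains \<open>\<kappa>\<close>, \<open>\<epsilon>\<close> and the velocities \<open>v\<^sub>1\<close>, \<open>v\<^sub>2\<close> in the body frame. Then
  \<open>y = \<T>(p, U)\<close> means that \<open>\<partial>\<^sub>x U = U \<kappa>\<close> and \<open>\<partial>\<^sub>t U = U v\<^sub>2\<close> (as skew-symmetric matrices), \<open>\<partial>\<^sub>x p = U \<epsilon>\<close>,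
  \<open>\<partial>\<^sub>t p = U v\<^sub>1\<close>. The last six equations of the intrinsic system are the integrability conditions of
  these overdetermined systems, and for such \<open>(p, U)\<close> the first six are the balance laws
  written in the moving frame. So \<open>y\<close> can be integrated to a beam motion; conversely the
  transform of a beam motion solves the intrinsic system, where it is unique, and two frames with
  the same angular velocity and initial value agree because \<open>U U'\<^sup>T\<close> is constant in time.
\<close>

section \<open>Calculus on a rectangle\<close>

text \<open>The frame equations are linear in \<open>U\<close>, so the frame exists on the whole
  rectangle for the given \<open>T\<close>. That it stays in SO(3) is not imposed but conserved,
  because the coefficients are skew-symmetric. The frame is found before the position: its two
  equations do not involve \<open>p\<close>, and once \<open>U\<close> is known, \<open>p\<close> is
  the potential of a closed form. Integration starts from the side t = 0, where the initial
  configuration is given; the clamped end then follows from v(0,t) = 0. Two obstacles shape the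
  details. Both systems prescribe their equations only in the open rectangle and on open edges,
  whereas integration needs identities up to the boundary, so these are first extended by
  continuity. And \<open>y\<close> is merely C^1, so the second-order regularity of \<open>p\<close>
  and \<open>U\<close> has to be read off from the form of their first derivatives.\<close>

abbreviation cont_rect :: "real \<Rightarrow> real \<Rightarrow> (real \<Rightarrow> real \<Rightarrow> 'a::real_normed_vector) \<Rightarrow> bool" where
  "cont_rect l T f \<equiv> continuous_on ({0..l} \<times> {0..T}) (\<lambda>(x, t). f x t)"

text \<open>The partial derivatives are arguments, so that the linear, sum and product rules below
  produce them as explicit terms. As in \<open>Ck_rect\<close>, they are one-sided at the
  boundary.\<close>

definition C1_rect ::
  "real \<Rightarrow> real \<Rightarrow> (real \<Rightarrow> real \<Rightarrow> 'a::real_normed_vector) \<Rightarrow>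
   (real \<Rightarrow> real \<Rightarrow> 'a) \<Rightarrow> (real \<Rightarrow> real \<Rightarrow> 'a) \<Rightarrow> bool" where
  "C1_rect l T f fx ft \<longleftrightarrow> cont_rect l T f \<and> cont_rect l T fx \<and> cont_rect l T ft \<and>
     (\<forall>x\<in>{0..l}. \<forall>t\<in>{0..T}.
        ((\<lambda>\<xi>. f \<xi> t) has_vector_derivative fx x t) (at x within {0..l}) \<and>
        ((\<lambda>\<tau>. f x \<tau>) has_vector_derivative ft x t) (at t within {0..T}))"

lemma C1_rectD:
  assumes "C1_rect l T f fx ft"
  shows "cont_rect l T f" "cont_rect l T fx" "cont_rect l T ft"
    and "\<And>x t. x \<in> {0..l} \<Longrightarrow> t \<in> {0..T} \<Longrightarrow>
           ((\<lambda>\<xi>. f \<xi> t) has_vector_derivative fx x t) (at x within {0..l})"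
    and "\<And>x t. x \<in> {0..l} \<Longrightarrow> t \<in> {0..T} \<Longrightarrow>
           ((\<lambda>\<tau>. f x \<tau>) has_vector_derivative ft x t) (at t within {0..T})"
  using assms by (auto simp: C1_rect_def)

lemma cont_rect_cong:
  assumes "cont_rect l T f" "\<And>x t. x \<in> {0..l} \<Longrightarrow> t \<in> {0..T} \<Longrightarrow> g x t = f x t"
  shows "cont_rect l T g"
  using assms(1) by (rule continuous_on_eq) (use assms(2) in auto)

lemma cont_rect_slice_x:
  assumes "cont_rect l T f" "t \<in> {0..T}" shows "continuous_on {0..l} (\<lambda>x. f x t)"
proof -
  have "continuous_on {0..l} (\<lambda>x. (x, t))" by (intro continuous_intros)
  from continuous_on_compose2[OF assms(1) this] show ?thesis using assms(2) by (auto simp: image_subset_iff)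
qed

lemma cont_rect_slice_t:
  assumes "cont_rect l T f" "x \<in> {0..l}" shows "continuous_on {0..T} (\<lambda>t. f x t)"
proof -
  have "continuous_on {0..T} (\<lambda>t. (x, t))" by (intro continuous_intros)
  from continuous_on_compose2[OF assms(1) this] show ?thesis using assms(2) by (auto simp: image_subset_iff)
qed

lemma cont_rect_fst:
  assumes "continuous_on {0..l} f" shows "cont_rect l T (\<lambda>x t. f x)"
  unfolding case_prod_unfold by (rule continuous_on_compose2[OF assms]) (auto intro!: continuous_intros)

lemma cont_rect_linear:
  assumes "bounded_linear h" "cont_rect l T f"
  shows "cont_rect l T (\<lambda>x t. h (f x t))"
  using bounded_linear.continuous_on[OF assms] by (simp add: case_prod_unfold)

lemma cont_rect_bilinear:
  assumes "bounded_bilinear h" "cont_rect l T f" "cont_rect l T g"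
  shows "cont_rect l T (\<lambda>x t. h (f x t) (g x t))"
  using bounded_bilinear.continuous_on[OF assms(1) assms(2) assms(3)] by (simp add: case_prod_unfold)

lemma cont_rect_add:
  "cont_rect l T f \<Longrightarrow> cont_rect l T g \<Longrightarrow> cont_rect l T (\<lambda>x t. f x t + g x t)"
  using continuous_on_add[of "{0..l}\<times>{0..T}" "\<lambda>(x, t). f x t" "\<lambda>(x, t). g x t"]
  by (simp add: case_prod_unfold)

lemma cont_rect_diff:
  "cont_rect l T f \<Longrightarrow> cont_rect l T g \<Longrightarrow> cont_rect l T (\<lambda>x t. f x t - g x t)"
  using continuous_on_diff[of "{0..l}\<times>{0..T}" "\<lambda>(x, t). f x t" "\<lambda>(x, t). g x t"]
  by (simp add: case_prod_unfold)

lemma cont_rect_bound: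
  assumes "cont_rect l T f"
  obtains B where "0 < B" "\<And>x t. x \<in> {0..l} \<Longrightarrow> t \<in> {0..T} \<Longrightarrow> norm (f x t) \<le> B"
proof -
  have "bounded ((\<lambda>(x, t). f x t) ` ({0..l} \<times> {0..T}))"
    by (intro compact_imp_bounded compact_continuous_image assms compact_Times) auto
  then obtain B where "0 < B" "\<forall>y\<in>(\<lambda>(x, t). f x t) ` ({0..l} \<times> {0..T}). norm y \<le> B"
    using bounded_pos by blast
  then show ?thesis by (intro that[of B]) auto
qed

text \<open>The open rectangle is dense in the closed one because both sides have positive length.
  \<open>continuous_on_eq_closed\<close> does the same for a single edge.\<close>

lemma cont_rect_eq_closed:
  assumes "cont_rect l T f" "cont_rect l T g" "0 < l" "0 < T"
    and "\<And>x t. x \<in> {0<..<l} \<Longrightarrow> t \<in> {0<..<T} \<Longrightarrow> f x t = g x t"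
    and "x \<in> {0..l}" "t \<in> {0..T}"
  shows "f x t = g x t"
proof -
  let ?S = "{0<..<l} \<times> {0<..<T}"
  have cl: "closure ?S = {0..l} \<times> {0..T}"
    using assms(3,4) by (simp add: closure_Times)
  have "(\<lambda>(x, t). f x t - g x t) (x, t) = 0"
    by (rule continuous_constant_on_closure[of ?S])
       (use cl cont_rect_diff[OF assms(1,2)] assms(5-7) in auto)
  then show ?thesis by simp
qed

lemma continuous_on_eq_closed:
  fixes f g :: "real \<Rightarrow> 'a::real_normed_vector"
  assumes "continuous_on {0..l} f" "continuous_on {0..l} g" "0 < l"
    and "\<And>x. x \<in> {0<..<l} \<Longrightarrow> f x = g x" and "x \<in> {0..l}"
  shows "f x = g x"
proof -
  have cl: "closure {0<..<l} = {0..l}" using assms(3) by simp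
  have "f x - g x = 0"
    by (rule continuous_constant_on_closure[of "{0<..<l}" "\<lambda>x. f x - g x"])
       (use cl continuous_on_diff[OF assms(1,2)] assms(4,5) in auto)
  then show ?thesis by simp
qed

lemma C1_rect_cong:
  assumes C1: "C1_rect l T f fx ft"
    and f: "\<And>x t. x \<in> {0..l} \<Longrightarrow> t \<in> {0..T} \<Longrightarrow> g x t = f x t"
    and fx: "\<And>x t. x \<in> {0..l} \<Longrightarrow> t \<in> {0..T} \<Longrightarrow> gx x t = fx x t"
    and ft: "\<And>x t. x \<in> {0..l} \<Longrightarrow> t \<in> {0..T} \<Longrightarrow> gt x t = ft x t"
  shows "C1_rect l T g gx gt"
  unfolding C1_rect_def
proof (intro conjI ballI)
  show "cont_rect l T g" "cont_rect l T gx" "cont_rect l T gt"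
    using C1_rectD(1-3)[OF C1] f fx ft by (blast intro: cont_rect_cong)+
  fix x t assume x: "x \<in> {0..l}" and t: "t \<in> {0..T}"
  show "((\<lambda>\<xi>. g \<xi> t) has_vector_derivative gx x t) (at x within {0..l})"
    unfolding fx[OF x t]
    by (rule has_vector_derivative_transform[OF x _ C1_rectD(4)[OF C1 x t]]) (use f t in auto)
  show "((\<lambda>\<tau>. g x \<tau>) has_vector_derivative gt x t) (at t within {0..T})"
    unfolding ft[OF x t]
    by (rule has_vector_derivative_transform[OF t _ C1_rectD(5)[OF C1 x t]]) (use f x in auto)
qed

lemma C1_rect_linear:
  assumes h: "bounded_linear h" and C1: "C1_rect l T f fx ft"
  shows "C1_rect l T (\<lambda>x t. h (f x t)) (\<lambda>x t. h (fx x t)) (\<lambda>x t. h (ft x t))"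
  using C1 unfolding C1_rect_def
  by (auto intro!: cont_rect_linear[OF h] bounded_linear.has_vector_derivative[OF h])

lemma C1_rect_bilinear:
  assumes h: "bounded_bilinear h" and f: "C1_rect l T f fx ft" and g: "C1_rect l T g gx gt"
  shows "C1_rect l T (\<lambda>x t. h (f x t) (g x t)) (\<lambda>x t. h (f x t) (gx x t) + h (fx x t) (g x t))
           (\<lambda>x t. h (f x t) (gt x t) + h (ft x t) (g x t))"
  using f g unfolding C1_rect_def
  by (auto intro!: cont_rect_bilinear[OF h] cont_rect_add bounded_bilinear.has_vector_derivative[OF h])

lemma C1_rect_add:
  assumes f: "C1_rect l T f fx ft" and g: "C1_rect l T g gx gt"
  shows "C1_rect l T (\<lambda>x t. f x t + g x t) (\<lambda>x t. fx x t + gx x t) (\<lambda>x t. ft x t + gt x t)"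
  using f g unfolding C1_rect_def
  by (auto intro!: cont_rect_add has_vector_derivative_add)

lemma C1_rect_diff:
  assumes f: "C1_rect l T f fx ft" and g: "C1_rect l T g gx gt"
  shows "C1_rect l T (\<lambda>x t. f x t - g x t) (\<lambda>x t. fx x t - gx x t) (\<lambda>x t. ft x t - gt x t)"
  using f g unfolding C1_rect_def
  by (auto intro!: cont_rect_diff has_vector_derivative_diff)

lemma C1_rect_const: "C1_rect l T (\<lambda>x t. c) (\<lambda>x t. 0) (\<lambda>x t. 0)"
  by (auto simp: C1_rect_def case_prod_unfold intro!: continuous_intros)

lemma C1_rect_seg:
  assumes "continuous_on {0..l} f'"
    and "\<And>x. x \<in> {0..l} \<Longrightarrow> (f has_vector_derivative f' x) (at x within {0..l})"
  shows "C1_rect l T (\<lambda>x t. f x) (\<lambda>x t. f' x) (\<lambda>x t. 0)"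
proof -
  have "continuous_on {0..l} f"
    using assms(2) continuous_on_vector_derivative by blast
  then show ?thesis
    using assms cont_rect_fst C1_rect_const[of l T 0] by (auto simp: C1_rect_def)
qed

section \<open>From the classes \<open>Ck_seg\<close> and \<open>Ck_rect\<close> to explicit
  derivatives and back\<close>

lemma Ck_seg_1D:
  assumes "Ck_seg 1 l f"
  shows "continuous_on {0..l} f" "continuous_on {0..l} (Dseg l f)"
    and "\<And>x. x \<in> {0..l} \<Longrightarrow> (f has_vector_derivative Dseg l f x) (at x within {0..l})"
  using assms by (auto simp: differentiable_on_def Dseg_def vector_derivative_works)

lemma Ck_seg_2D:
  assumes "Ck_seg 2 l f"
  shows "Ck_seg 1 l f" "Ck_seg 1 l (Dseg l f)"
  using assms by (auto simp: numeral_2_eq_2)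

text \<open>A derivative within \<open>{0..l}\<close> is unique only if the interval has more than
  one point, hence \<open>0 < l\<close>.\<close>

lemma Dx_eq:
  assumes "0 < l" "x \<in> {0..l}" "((\<lambda>\<xi>. f \<xi> t) has_vector_derivative f') (at x within {0..l})"
  shows "Dx l f x t = f'"
  unfolding Dx_def using vector_derivative_within_cbox[of 0 l x _ f'] assms by simp

lemma Dt_eq:
  assumes "0 < T" "t \<in> {0..T}" "((\<lambda>\<tau>. f x \<tau>) has_vector_derivative f') (at t within {0..T})"
  shows "Dt T f x t = f'"
  unfolding Dt_def using vector_derivative_within_cbox[of 0 T t _ f'] assms by simp

lemma C1_rect_Dx: "C1_rect l T f fx ft \<Longrightarrow> 0 < l \<Longrightarrow> x \<in> {0..l} \<Longrightarrow> t \<in> {0..T} \<Longrightarrow> Dx l f x t = fx x t"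
  using Dx_eq C1_rectD(4) by blast

lemma C1_rect_Dt: "C1_rect l T f fx ft \<Longrightarrow> 0 < T \<Longrightarrow> x \<in> {0..l} \<Longrightarrow> t \<in> {0..T} \<Longrightarrow> Dt T f x t = ft x t"
  using Dt_eq C1_rectD(5) by blast

lemma Ck_rect_1_iff: "Ck_rect 1 l T f \<longleftrightarrow> C1_rect l T f (Dx l f) (Dt T f)"
  by (auto simp: C1_rect_def differentiable_on_def Dx_def Dt_def vector_derivative_works)

lemma Ck_rect_1I:
  assumes "C1_rect l T f fx ft" "0 < l" "0 < T"
  shows "Ck_rect 1 l T f"
  unfolding Ck_rect_1_iff
  by (rule C1_rect_cong[OF assms(1)]) (auto simp: C1_rect_Dx[OF assms(1)] C1_rect_Dt[OF assms(1)] assms(2,3))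

lemma Ck_rect_2_iff:
  "Ck_rect 2 l T f \<longleftrightarrow>
     C1_rect l T f (Dx l f) (Dt T f) \<and> Ck_rect 1 l T (Dx l f) \<and> Ck_rect 1 l T (Dt T f)"
  by (auto simp: numeral_2_eq_2 C1_rect_def differentiable_on_def Dx_def Dt_def vector_derivative_works)

lemma Ck_rect_2I:
  assumes f: "C1_rect l T f fx ft" and fx: "C1_rect l T fx fxx fxt" and ft: "C1_rect l T ft ftx ftt"
    and pos: "0 < l" "0 < T"
  shows "Ck_rect 2 l T f"
proof -
  have "C1_rect l T (Dx l f) fxx fxt" "C1_rect l T (Dt T f) ftx ftt"
    by (rule C1_rect_cong[OF fx] C1_rect_cong[OF ft], auto simp: C1_rect_Dx[OF f] C1_rect_Dt[OF f] pos)+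
  then show ?thesis
    unfolding Ck_rect_2_iff using Ck_rect_1I pos f Ck_rect_1_iff by blast
qed

section \<open>Inverse matrices\<close>

lemma continuous_on_det:
  fixes A :: "'a::topological_space \<Rightarrow> real ^ 'n ^ 'n"
  assumes "continuous_on S A"
  shows "continuous_on S (\<lambda>x. det (A x))"
  unfolding det_def using assms
  by (auto intro!: continuous_intros continuous_on_prod bounded_linear.continuous_on[OF bounded_linear_vec_nth])

lemma matrix_inv_right: "A ** matrix_inv A = mat 1"
  and matrix_inv_left: "matrix_inv A ** A = mat 1"
  if "invertible A"
  using someI_ex[OF that[unfolded invertible_def]] by (simp_all add: matrix_inv_def)

text \<open>Cramer's rule for column \<open>m\<close> of the inverse, which is the solution of
  \<open>A *v u = axis m 1\<close>. The entries become quotients of determinants, from which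
  continuity of the inverse follows.\<close>

lemma matrix_inv_nth:
  fixes A :: "real ^ 'n ^ 'n"
  assumes "invertible A"
  shows "matrix_inv A $ k $ m = det (\<chi> i j. if j = k then axis m 1 $ i else A $ i $ j) / det A"
proof -
  have "A *v (matrix_inv A *v axis m 1) = axis m 1"
    using assms by (simp add: matrix_vector_mul_assoc matrix_inv_right)
  then have "matrix_inv A *v axis m 1 = (\<chi> k. det (\<chi> i j. if j = k then axis m 1 $ i else A $ i $ j) / det A)"
    using assms by (simp add: cramer invertible_det_nz)
  then show ?thesis
    by (simp add: matrix_vector_mult_basis column_def vec_eq_iff)
qed

lemma continuous_on_matrix_inv:
  fixes A :: "'a::topological_space \<Rightarrow> real ^ 'n ^ 'n"
  assumes A: "continuous_on S A" and inv: "\<And>x. x \<in> S \<Longrightarrow> invertible (A x)"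
  shows "continuous_on S (\<lambda>x. matrix_inv (A x))"
proof -
  have "continuous_on S (\<lambda>x. det (\<chi> i j. if j = k then axis m 1 $ i else A x $ i $ j) / det (A x))" for k m
  proof -
    have "continuous_on S (\<lambda>x. if j = k then axis m 1 $ i else A x $ i $ j)" for i j
      using A by (cases "j = k") (auto intro!: continuous_intros)
    then show ?thesis
      using inv A invertible_det_nz by (auto intro!: continuous_intros continuous_on_det)
  qed
  from this have "continuous_on S (\<lambda>x. matrix_inv (A x) $ k $ m)" for k m
    by (rule continuous_on_eq[of S "\<lambda>x. det (\<chi> i j. if j = k then axis m 1 $ i else A x $ i $ j) / det (A x)"])
      (simp add: matrix_inv_nth inv)
  then have "continuous_on S (\<lambda>x. \<chi> k m. matrix_inv (A x) $ k $ m)"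
    by (intro continuous_on_vec_lambda)
  then show ?thesis by simp
qed

lemma bounded_bilinear_matrix_vector_mult:
  "bounded_bilinear ((*v) :: real ^ 'n ^ 'm \<Rightarrow> real ^ 'n \<Rightarrow> real ^ 'm)"
  unfolding bilinear_conv_bounded_bilinear[symmetric] bilinear_def
  by (auto intro!: linearI simp: matrix_vector_mult_def vec_eq_iff sum.distrib algebra_simps sum_distrib_left)

lemma bounded_bilinear_matrix_mult:
  "bounded_bilinear ((**) :: real ^ 'n ^ 'm \<Rightarrow> real ^ 'p ^ 'n \<Rightarrow> real ^ 'p ^ 'm)"
  unfolding bilinear_conv_bounded_bilinear[symmetric] bilinear_def
  by (auto intro!: linearI simp: matrix_matrix_mult_def vec_eq_iff sum.distrib algebra_simps sum_distrib_left)

text \<open>The difference quotient form is what allows the derivative of the inverse matrix to be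
  computed as a limit of products.\<close>

lemma has_vector_derivative_within_quotient:
  "(f has_vector_derivative f') (at x within S) \<longleftrightarrow>
     ((\<lambda>y. (f y - f x) /\<^sub>R (y - x)) \<longlongrightarrow> f') (at x within S)"
proof -
  have eq: "norm (f y - f x - (y - x) *\<^sub>R f') / norm (y - x) = norm ((f y - f x) /\<^sub>R (y - x) - f')"
    if "y \<noteq> x" for y
  proof -
    have "f y - f x - (y - x) *\<^sub>R f' = (y - x) *\<^sub>R ((f y - f x) /\<^sub>R (y - x) - f')"
      using that by (simp add: scaleR_diff_right)
    then show ?thesis using that by simp
  qed
  have "(f has_vector_derivative f') (at x within S) \<longleftrightarrow>
      ((\<lambda>y. norm (f y - f x - (y - x) *\<^sub>R f') / norm (y - x)) \<longlongrightarrow> 0) (at x within S)"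
    unfolding has_vector_derivative_def has_derivative_iff_norm
    by (simp add: bounded_linear_scaleR_left)
  also have "\<dots> \<longleftrightarrow> ((\<lambda>y. norm ((f y - f x) /\<^sub>R (y - x) - f')) \<longlongrightarrow> 0) (at x within S)"
    by (rule tendsto_cong) (auto simp: eventually_at_filter eq simp del: real_norm_def)
  also have "\<dots> \<longleftrightarrow> ((\<lambda>y. (f y - f x) /\<^sub>R (y - x)) \<longlongrightarrow> f') (at x within S)"
    by (simp add: tendsto_norm_zero_iff LIM_zero_iff)
  finally show ?thesis .
qed

text \<open>The identity \<open>B \<xi> - B x = - (B \<xi> ** (A \<xi> - A x) ** B x)\<close> for
  the inverses \<open>B\<close> makes the difference quotient of \<open>B\<close> an exact product
  of three factors, each with a known limit.\<close>

lemma has_vector_derivative_matrix_inv: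
  fixes A :: "real \<Rightarrow> real ^ 'n ^ 'n"
  assumes A: "(A has_vector_derivative A') (at x within S)" and x: "x \<in> S"
    and cont: "continuous_on S A" and inv: "\<And>x. x \<in> S \<Longrightarrow> invertible (A x)"
  shows "((\<lambda>x. matrix_inv (A x)) has_vector_derivative - (matrix_inv (A x) ** A' ** matrix_inv (A x)))
           (at x within S)"
proof -
  let ?B = "\<lambda>x. matrix_inv (A x)"
  have eq: "(?B \<xi> - ?B x) /\<^sub>R (\<xi> - x) = - (?B \<xi> ** ((A \<xi> - A x) /\<^sub>R (\<xi> - x)) ** ?B x)" if "\<xi> \<in> S" for \<xi>
  proof -
    have "?B \<xi> ** (A \<xi> - A x) ** ?B x = ?B x - ?B \<xi>"
      using inv[OF x] inv[OF that]
      by (simp add: bounded_bilinear.diff_left[OF bounded_bilinear_matrix_mult]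
          bounded_bilinear.diff_right[OF bounded_bilinear_matrix_mult] matrix_inv_left matrix_inv_right
          matrix_mul_assoc[symmetric])
    then show ?thesis
      by (simp add: bounded_bilinear.scaleR_left[OF bounded_bilinear_matrix_mult]
          bounded_bilinear.scaleR_right[OF bounded_bilinear_matrix_mult] scaleR_minus_right[symmetric]
          del: scaleR_minus_right)
  qed
  have "(?B \<longlongrightarrow> ?B x) (at x within S)"
    using continuous_on_matrix_inv[OF cont inv] x by (simp add: continuous_on_def)
  moreover have "((\<lambda>\<xi>. (A \<xi> - A x) /\<^sub>R (\<xi> - x)) \<longlongrightarrow> A') (at x within S)"
    using A unfolding has_vector_derivative_within_quotient .
  ultimately have "((\<lambda>\<xi>. - (?B \<xi> ** ((A \<xi> - A x) /\<^sub>R (\<xi> - x)) ** ?B x)) \<longlongrightarrow> - (?B x ** A' ** ?B x)) (at x within S)"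
    by (intro tendsto_minus bounded_bilinear.tendsto[OF bounded_bilinear_matrix_mult] tendsto_const)
  then have "((\<lambda>\<xi>. (?B \<xi> - ?B x) /\<^sub>R (\<xi> - x)) \<longlongrightarrow> - (?B x ** A' ** ?B x)) (at x within S)"
    by (rule Lim_transform_eventually) (auto simp: eventually_at_filter eq)
  then show ?thesis
    unfolding has_vector_derivative_within_quotient .
qed

section \<open>Linear equations with a parameter\<close>

text \<open>The substitution \<tau> = t \<sigma> moves the variable limit of integration into the
  integrand; then continuity of integrals over the fixed interval \<open>{0..1}\<close>
  applies.\<close>

lemma cont_rect_integral_t:
  fixes g :: "real \<Rightarrow> real \<Rightarrow> 'a::banach"
  assumes g: "cont_rect l T g"
  shows "cont_rect l T (\<lambda>x t. integral {0..t} (g x))"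
proof -
  have scale: "integral {0..t} (g x) = t *\<^sub>R integral {0..1} (\<lambda>\<sigma>. g x (t * \<sigma>))"
    if x: "x \<in> {0..l}" and t: "t \<in> {0..T}" for x t
  proof (cases "t = 0")
    case False
    with t have pos: "0 < t" by simp
    have "continuous_on {0..t} (g x)"
      using cont_rect_slice_t[OF g x] by (rule continuous_on_subset) (use t in auto)
    then have "(g x has_integral integral {0..t} (g x)) {0..t}"
      by (intro integrable_integral integrable_continuous_real)
    from has_integral_stretch_real[OF this, of t] pos
    have "((\<lambda>\<sigma>. g x (t * \<sigma>)) has_integral (1 / t) *\<^sub>R integral {0..t} (g x)) ((\<lambda>x. x / t) ` {0..t})"
      by simp
    moreover have "(\<lambda>x. x / t) ` {0..t} = {0..1}"
      using pos by (simp add: image_divide_atLeastAtMost)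
    ultimately show ?thesis using pos by (simp add: integral_unique)
  qed simp
  have "continuous_on (({0..l} \<times> {0..T}) \<times> cbox 0 1) (\<lambda>(p, \<sigma>). g (fst p) (snd p * \<sigma>))"
  proof -
    have "continuous_on (({0..l} \<times> {0..T}) \<times> cbox 0 1) (\<lambda>q::(real \<times> real) \<times> real. (fst (fst q), snd (fst q) * snd q))"
      by (intro continuous_intros)
    from continuous_on_compose2[OF g this] have
      "continuous_on (({0..l} \<times> {0..T}) \<times> cbox 0 1) (\<lambda>q. g (fst (fst q)) (snd (fst q) * snd q))"
      by (fastforce simp: image_subset_iff intro: mult_le_one order_trans[OF mult_left_le])
    then show ?thesis by (simp add: case_prod_unfold)
  qed
  from integral_continuous_on_param[OF this]
  have "continuous_on ({0..l} \<times> {0..T}) (\<lambda>p. snd p *\<^sub>R integral {0..1} (\<lambda>\<sigma>. g (fst p) (snd p * \<sigma>)))"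
    by (intro continuous_intros) simp_all
  then show ?thesis
    by (rule continuous_on_eq) (auto simp: scale)
qed

lemma exp_has_integral:
  fixes a :: real
  assumes "a \<noteq> 0" "0 \<le> t"
  shows "((\<lambda>\<tau>. exp (a * \<tau>)) has_integral (exp (a * t) - 1) / a) {0..t}"
proof -
  have "((\<lambda>\<tau>. exp (a * \<tau>) / a) has_vector_derivative exp (a * \<tau>)) (at \<tau> within {0..t})" for \<tau>
    unfolding has_real_derivative_iff_has_vector_derivative[symmetric]
    using assms(1) by (auto intro!: derivative_eq_intros)
  from fundamental_theorem_of_calculus[OF assms(2) this] show ?thesis
    by (simp add: diff_divide_distrib)
qed

text \<open>
  With the weight \<open>exp (- a * t)\<close> and \<open>a\<close> large the integral operator is a contraction on the
  whole rectangle, so no splitting of the time interval is needed.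
\<close>

lemma linear_ode_parameter_exists:
  fixes h :: "'a::banach \<Rightarrow> 'b::real_normed_vector \<Rightarrow> 'a"
  assumes h: "bounded_bilinear h" and w: "cont_rect l T w" and u0: "continuous_on {0..l} u0"
    and nonneg: "0 \<le> l" "0 \<le> T"
  obtains u where "cont_rect l T u" "\<And>x. x \<in> {0..l} \<Longrightarrow> u x 0 = u0 x"
    and "\<And>x t. x \<in> {0..l} \<Longrightarrow> t \<in> {0..T} \<Longrightarrow>
      ((\<lambda>\<tau>. u x \<tau>) has_vector_derivative h (u x t) (w x t)) (at t within {0..T})"
proof -
  obtain H where H: "0 < H" "\<And>a b. norm (h a b) \<le> norm a * norm b * H"
    using bounded_bilinear.pos_bounded[OF h] by blast
  obtain B where B: "0 < B" "\<And>x t. x \<in> {0..l} \<Longrightarrow> t \<in> {0..T} \<Longrightarrow> norm (w x t) \<le> B"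
    using cont_rect_bound[OF w] by blast
  \<comment> \<open>In the weighted norm the integral operator has Lipschitz constant at most
    \<open>B * H / a\<close>; this choice makes it 1/2.\<close>
  define a where "a = 2 * B * H"
  have a: "0 < a" using B H by (simp add: a_def)
  \<comment> \<open>\<open>S\<close> stands for the unknown multiplied by
    \<open>exp (- a * t)\<close>. The fixed point is sought among the bounded continuous functions
    on the whole plane, which form a complete space.\<close>
  define g :: "((real \<times> real) \<Rightarrow>\<^sub>C 'a) \<Rightarrow> real \<Rightarrow> real \<Rightarrow> 'a"
    where "g S x \<tau> = exp (a * \<tau>) *\<^sub>R h (apply_bcontfun S (x, \<tau>)) (w x \<tau>)" for S x \<tau>
  define G where "G S x t = exp (- a * t) *\<^sub>R (u0 x + integral {0..t} (g S x))" for S x t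
  have g_cont: "cont_rect l T (g S)" for S
  proof -
    have "cont_rect l T (\<lambda>x t. h (S (x, t)) (w x t))"
      by (rule cont_rect_bilinear[OF h _ w]) simp
    then show ?thesis
      unfolding g_def case_prod_unfold by (intro continuous_intros)
  qed
  have g_int: "g S x integrable_on {0..t}" if "x \<in> {0..l}" "t \<in> {0..T}" for S x t
    by (intro integrable_continuous_real continuous_on_subset[OF cont_rect_slice_t[OF g_cont that(1)]])
      (use that in auto)
  have box: "cbox (0, 0) (l, T) = {0..l} \<times> {0..T}"
    by (simp add: cbox_Pair_eq)
  have G_cont: "continuous_on (cbox (0, 0) (l, T)) (\<lambda>p. G S (fst p) (snd p))" for S
    using cont_rect_integral_t[OF g_cont[of S]] cont_rect_fst[OF u0, of T]
    unfolding G_def box case_prod_unfold by (intro continuous_intros)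
  \<comment> \<open>\<open>clamp\<close> retracts the plane onto the rectangle. Composing with it
    extends \<open>G S\<close> to a bounded continuous function on the plane and leaves the values
    on the rectangle unchanged.\<close>
  have "\<exists>F. \<forall>p. apply_bcontfun F p = G S (fst (clamp (0, 0) (l, T) p)) (snd (clamp (0, 0) (l, T) p))" for S
    by (rule continuous_on_cbox_bcontfunE[OF G_cont[of S]]) blast
  then obtain \<Phi> where \<Phi>: "apply_bcontfun (\<Phi> S) p =
      G S (fst (clamp (0, 0) (l, T) p)) (snd (clamp (0, 0) (l, T) p))" for S p
    by metis
  have G_dist: "dist (G S x t) (G S' x t) \<le> 1/2 * dist S S'"
    if x: "x \<in> {0..l}" and t: "t \<in> {0..T}" for S S' x t
  proof -
    have "norm (g S x \<tau> - g S' x \<tau>) \<le> dist S S' * B * H * exp (a * \<tau>)" if "\<tau> \<in> {0..t}" for \<tau>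
    proof -
      have "g S x \<tau> - g S' x \<tau> = exp (a * \<tau>) *\<^sub>R h (S (x, \<tau>) - S' (x, \<tau>)) (w x \<tau>)"
        by (simp add: g_def bounded_bilinear.diff_left[OF h] scaleR_diff_right)
      also have "norm \<dots> \<le> exp (a * \<tau>) * (norm (S (x, \<tau>) - S' (x, \<tau>)) * norm (w x \<tau>) * H)"
        using H(2)[of "S (x, \<tau>) - S' (x, \<tau>)" "w x \<tau>"] by simp
      also have "\<dots> \<le> exp (a * \<tau>) * (dist S S' * B * H)"
        using B H(1) x t that dist_bounded[of S "(x, \<tau>)" S']
        by (intro mult_left_mono mult_right_mono mult_mono) (auto simp: dist_norm)
      finally show ?thesis by (simp add: ac_simps)
    qed
    moreover have "((\<lambda>\<tau>. dist S S' * B * H * exp (a * \<tau>)) has_integral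
        dist S S' * B * H * ((exp (a * t) - 1) / a)) {0..t}"
      using a t by (intro has_integral_mult_right exp_has_integral) auto
    ultimately have "norm (integral {0..t} (\<lambda>\<tau>. g S x \<tau> - g S' x \<tau>)) \<le>
        dist S S' * B * H * ((exp (a * t) - 1) / a)"
      using integral_norm_bound_integral[OF integrable_diff[OF g_int[OF x t] g_int[OF x t]]]
      by (metis (no_types, lifting) has_integral_integrable_integral)
    also have "\<dots> = 1/2 * dist S S' * (exp (a * t) - 1)"
      using B H by (simp add: a_def field_simps)
    also have "\<dots> \<le> 1/2 * dist S S' * exp (a * t)"
      by (intro mult_left_mono) auto
    finally have "norm (integral {0..t} (g S x) - integral {0..t} (g S' x)) \<le> 1/2 * dist S S' * exp (a * t)"
      by (simp add: integral_diff[OF g_int[OF x t] g_int[OF x t]])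
    then have "exp (- a * t) * norm (integral {0..t} (g S x) - integral {0..t} (g S' x)) \<le> 
        exp (- a * t) * (1/2 * dist S S' * exp (a * t))"
      by (intro mult_left_mono) auto
    also have "\<dots> = 1/2 * dist S S'" by (simp add: exp_minus)
    finally show ?thesis
      by (simp add: G_def dist_norm scaleR_diff_right[symmetric])
  qed
  have "\<exists>!S. \<Phi> S = S"
  proof (rule banach_fix_type[of "1/2"], simp, simp, intro allI)
    fix S S'
    show "dist (\<Phi> S) (\<Phi> S') \<le> 1/2 * dist S S'"
    proof (rule dist_bound)
      fix p
      have "clamp (0, 0) (l, T) p \<in> {0..l} \<times> {0..T}"
        unfolding box[symmetric] using nonneg
        by (intro clamp_in_interval) (auto simp: Basis_prod_def)
      then show "dist (\<Phi> S p) (\<Phi> S' p) \<le> 1/2 * dist S S'"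
        unfolding \<Phi> by (intro G_dist) auto
    qed
  qed
  then obtain S where S: "\<Phi> S = S" by blast
  define u where "u x t = exp (a * t) *\<^sub>R S (x, t)" for x t
  have u: "u x t = u0 x + integral {0..t} (g S x)" if "x \<in> {0..l}" "t \<in> {0..T}" for x t
  proof -
    have "clamp (0, 0) (l, T) (x, t) = (x, t)"
      by (rule clamp_cancel_cbox) (use that box in auto)
    then have "S (x, t) = G S x t"
      using \<Phi>[of S "(x, t)"] S by simp
    then show ?thesis by (simp add: u_def G_def exp_minus)
  qed
  have g_eq: "g S x t = h (u x t) (w x t)" for x t
    by (simp add: g_def u_def bounded_bilinear.scaleR_left[OF h])
  show thesis
  proof
    show "cont_rect l T u"
      unfolding u_def case_prod_unfold by (intro continuous_intros) simp
    show "u x 0 = u0 x" if "x \<in> {0..l}" for x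
      using u[OF that, of 0] nonneg by simp
    show "((\<lambda>\<tau>. u x \<tau>) has_vector_derivative h (u x t) (w x t)) (at t within {0..T})"
      if x: "x \<in> {0..l}" and t: "t \<in> {0..T}" for x t
    proof -
      have "((\<lambda>\<tau>. integral {0..\<tau>} (g S x)) has_vector_derivative g S x t) (at t within {0..T})"
        by (rule integral_has_vector_derivative[OF cont_rect_slice_t[OF g_cont x] t])
      then have "((\<lambda>\<tau>. u0 x + integral {0..\<tau>} (g S x)) has_vector_derivative h (u x t) (w x t))
          (at t within {0..T})"
        unfolding g_eq[symmetric] by (auto intro!: derivative_eq_intros)
      then show ?thesis
        by (rule has_vector_derivative_transform[OF t, rotated]) (use u x in auto)
    qed
  qed
qed

text \<open>At a maximum point of \<open>exp (- a * t) * norm (D x t)\<close>, integrating the bound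
  for the derivative in time shows that the maximum is at most half of itself. The derivative at one
  point is estimated by the supremum over all of \<open>{0..l}\<close> at the same time, because in
  the application it contains an integral over x.\<close>

lemma gronwall_sup_zero:
  fixes D :: "real \<Rightarrow> real \<Rightarrow> 'a::real_normed_vector"
  assumes D: "cont_rect l T D" and D0: "\<And>x. x \<in> {0..l} \<Longrightarrow> D x 0 = 0"
    and deriv: "\<And>x t. x \<in> {0..l} \<Longrightarrow> t \<in> {0..T} \<Longrightarrow>
      ((\<lambda>\<tau>. D x \<tau>) has_vector_derivative D' x t) (at t within {0..T})"
    and L: "0 \<le> L"
    and bound: "\<And>x t k. x \<in> {0..l} \<Longrightarrow> t \<in> {0..T} \<Longrightarrow> (\<And>\<xi>. \<xi> \<in> {0..l} \<Longrightarrow> norm (D \<xi> t) \<le> k) \<Longrightarrow>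
      norm (D' x t) \<le> L * k"
    and xt: "x \<in> {0..l}" "t \<in> {0..T}"
  shows "D x t = 0"
proof -
  \<comment> \<open>\<open>2 * L \<le> a\<close> yields the factor 1/2 after integrating the
    exponential; the summand 1 keeps \<open>a\<close> positive when \<open>L = 0\<close>.\<close>
  define a where "a = 2 * L + 1"
  have a: "0 < a" using L by (simp add: a_def)
  have "continuous_on ({0..l} \<times> {0..T}) (\<lambda>p. exp (- a * snd p) * norm (D (fst p) (snd p)))"
    using D by (intro continuous_intros) (simp add: case_prod_unfold)
  from continuous_attains_sup[OF _ _ this] xt obtain x0 t0 where
    m: "x0 \<in> {0..l}" "t0 \<in> {0..T}" and
    max: "\<And>x t. x \<in> {0..l} \<Longrightarrow> t \<in> {0..T} \<Longrightarrow>
      exp (- a * t) * norm (D x t) \<le> exp (- a * t0) * norm (D x0 t0)"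
    by (fastforce simp: compact_Times)
  define k where "k = exp (- a * t0) * norm (D x0 t0)"
  have k: "0 \<le> k" by (simp add: k_def)
  have D_le: "norm (D x t) \<le> k * exp (a * t)" if "x \<in> {0..l}" "t \<in> {0..T}" for x t
    using max[OF that] unfolding k_def[symmetric] by (simp add: exp_minus field_simps)
  have "norm (D x0 t0) \<le> k / 2 * exp (a * t0)"
  proof (cases "t0 = 0")
    case True
    then show ?thesis using D0[OF m(1)] k by simp
  next
    case False
    then have "0 < t0" using m by simp
    then have "norm (D x0 t0 - D x0 0) \<le> k / 2 * exp (a * t0) - k / 2 * exp (a * 0)"
    proof (rule differentiable_bound_general)
      show "continuous_on {0..t0} (\<lambda>\<tau>. D x0 \<tau>)"
        by (rule continuous_on_subset[OF cont_rect_slice_t[OF D m(1)]]) (use m in auto)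
      show "continuous_on {0..t0} (\<lambda>\<tau>. k / 2 * exp (a * \<tau>))"
        by (intro continuous_intros)
      fix \<tau> assume \<tau>: "0 < \<tau>" "\<tau> < t0"
      then have \<tau>': "\<tau> \<in> {0..T}" using m by simp
      show "((\<lambda>\<tau>. D x0 \<tau>) has_vector_derivative D' x0 \<tau>) (at \<tau>)"
        using deriv[OF m(1) \<tau>'] \<tau> m by (simp add: at_within_Icc_at)
      show "((\<lambda>\<tau>. k / 2 * exp (a * \<tau>)) has_vector_derivative k / 2 * (a * exp (a * \<tau>))) (at \<tau>)"
        unfolding has_real_derivative_iff_has_vector_derivative[symmetric]
        by (auto intro!: derivative_eq_intros)
    have "norm (D' x0 \<tau>) \<le> L * (k * exp (a * \<tau>))"
      by (rule bound[OF m(1) \<tau>']) (use D_le \<tau>' in auto)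
    also have "\<dots> = k * exp (a * \<tau>) * L" by simp
    also have "\<dots> \<le> k * exp (a * \<tau>) * (a / 2)"
      using k by (intro mult_left_mono) (auto simp: a_def)
    finally show "norm (D' x0 \<tau>) \<le> k / 2 * (a * exp (a * \<tau>))" by (simp add: ac_simps)
  qed
    then show ?thesis using D0[OF m(1)] k by simp
  qed
  then have "k \<le> k / 2"
    by (simp add: k_def exp_minus field_simps)
  then have "k = 0" using k by simp
  then show ?thesis using D_le[OF xt] by simp
qed

section \<open>Integrability\<close>

lemma cont_rect_swap:
  assumes "cont_rect l T f" shows "cont_rect T l (\<lambda>t x. f x t)"
proof -
  have "continuous_on ({0..T} \<times> {0..l}) (\<lambda>q::real \<times> real. (snd q, fst q))" by (intro continuous_intros)
  from continuous_on_compose2[OF assms this] show ?thesis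
    by (auto simp: case_prod_unfold image_subset_iff)
qed

lemma cont_rect_integral_x:
  fixes g :: "real \<Rightarrow> real \<Rightarrow> 'a::banach"
  assumes "cont_rect l T g"
  shows "cont_rect l T (\<lambda>x t. integral {0..x} (\<lambda>\<xi>. g \<xi> t))"
  using cont_rect_swap[OF cont_rect_integral_t[OF cont_rect_swap[OF assms]]] .

text \<open>Only continuity of \<open>fx\<close> is known beforehand. Differentiating
  \<open>f x s - f x 0\<close>, the time integral of \<open>ft\<close>, under the integral sign
  gives \<open>fx x s = fx x 0 + integral {0..s} (ftx x)\<close>, whose right-hand side is
  differentiable in \<open>s\<close>.\<close>

lemma mixed_derivative:
  fixes f :: "real \<Rightarrow> real \<Rightarrow> 'a::banach"
  assumes f: "C1_rect l T f fx ft" and ft: "C1_rect l T ft ftx ftt"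
    and l: "0 < l" and x: "x \<in> {0..l}" and t: "t \<in> {0..T}"
  shows "((\<lambda>\<tau>. fx x \<tau>) has_vector_derivative ftx x t) (at t within {0..T})"
proof -
  have fx_eq: "fx x s = fx x 0 + integral {0..s} (ftx x)" if s: "s \<in> {0..T}" for s
  proof -
    have s0: "0 \<in> {0..T}" and sub: "{0..s} \<subseteq> {0..T}" using s by auto
    have int: "ft \<xi> integrable_on {0..s}" if "\<xi> \<in> {0..l}" for \<xi>
      by (intro integrable_continuous_real continuous_on_subset[OF cont_rect_slice_t[OF C1_rectD(1)[OF ft] that] sub])
    have "((\<lambda>\<xi>. integral (cbox 0 s) (ft \<xi>)) has_vector_derivative integral (cbox 0 s) (ftx x)) (at x within {0..l})"
    proof (rule leibniz_rule_vector_derivative)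
      show "continuous_on ({0..l} \<times> cbox 0 s) (\<lambda>(x, t). ftx x t)"
        by (rule continuous_on_subset[OF C1_rectD(2)[OF ft]]) (use s in auto)
    qed (use int x s C1_rectD(4)[OF ft] in auto)
    moreover have "integral (cbox 0 s) (ft \<xi>) = f \<xi> s - f \<xi> 0" if "\<xi> \<in> {0..l}" for \<xi>
    proof -
      have "(ft \<xi> has_integral f \<xi> s - f \<xi> 0) {0..s}"
      proof (rule fundamental_theorem_of_calculus)
        show "((\<lambda>t. f \<xi> t) has_vector_derivative ft \<xi> \<tau>) (at \<tau> within {0..s})" if "\<tau> \<in> {0..s}" for \<tau>
          by (rule has_vector_derivative_within_subset[OF C1_rectD(5)[OF f \<open>\<xi> \<in> {0..l}\<close>] sub])
            (use that s in auto)
      qed (use s in auto)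
      then show ?thesis by (simp add: integral_unique)
    qed
    ultimately have "((\<lambda>\<xi>. f \<xi> s - f \<xi> 0) has_vector_derivative integral {0..s} (ftx x)) (at x within {0..l})"
      using has_vector_derivative_transform[OF x, of "\<lambda>\<xi>. f \<xi> s - f \<xi> 0" "\<lambda>\<xi>. integral (cbox 0 s) (ft \<xi>)"]
      by simp
    moreover have "((\<lambda>\<xi>. f \<xi> s - f \<xi> 0) has_vector_derivative fx x s - fx x 0) (at x within {0..l})"
      by (intro has_vector_derivative_diff C1_rectD(4)[OF f x] s s0)
    ultimately have "integral {0..s} (ftx x) = fx x s - fx x 0"
      using vector_derivative_unique_within_closed_interval[of 0 l x "\<lambda>\<xi>. f \<xi> s - f \<xi> 0"] l x by simp
    then show ?thesis by simp
  qed
  have "((\<lambda>s. integral {0..s} (ftx x)) has_vector_derivative ftx x t) (at t within {0..T})"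
    by (rule integral_has_vector_derivative[OF cont_rect_slice_t[OF C1_rectD(2)[OF ft] x] t])
  then have "((\<lambda>s. fx x 0 + integral {0..s} (ftx x)) has_vector_derivative ftx x t) (at t within {0..T})"
    by (auto intro!: derivative_eq_intros)
  then show ?thesis
    by (rule has_vector_derivative_transform[OF t fx_eq, rotated])
qed

lemma mixed_derivatives_eq:
  fixes f :: "real \<Rightarrow> real \<Rightarrow> 'a::banach"
  assumes "C1_rect l T f fx ft" "C1_rect l T fx fxx fxt" "C1_rect l T ft ftx ftt"
    and "0 < l" "0 < T" "x \<in> {0..l}" "t \<in> {0..T}"
  shows "fxt x t = ftx x t"
  using vector_derivative_unique_within_closed_interval[of 0 T t "\<lambda>\<tau>. fx x \<tau>"]
    mixed_derivative[OF assms(1,3,4,6,7)] C1_rectD(5)[OF assms(2,6,7)] assms(5,7) by simp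

text \<open>The Poincare lemma on a rectangle, for the closed form a dx + b dt. Integrating
  \<open>b\<close> in time from \<open>p0\<close>, one gets as x-derivative of the integral the time
  integral of \<open>bx\<close>, hence of \<open>a'\<close>, that is \<open>a x t - a x 0\<close>;
  the derivative of \<open>p0\<close> supplies the missing term.\<close>

lemma potential_exists:
  fixes a b :: "real \<Rightarrow> real \<Rightarrow> 'a::banach"
  assumes a: "C1_rect l T a ax a'" and b: "C1_rect l T b bx bt"
    and compat: "\<And>x t. x \<in> {0..l} \<Longrightarrow> t \<in> {0..T} \<Longrightarrow> a' x t = bx x t"
    and p0: "\<And>x. x \<in> {0..l} \<Longrightarrow> (p0 has_vector_derivative a x 0) (at x within {0..l})"
    and T: "0 \<le> T"
  obtains p where "C1_rect l T p a b" "\<And>x. p x 0 = p0 x"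
proof -
  define p where "p x t = p0 x + integral {0..t} (b x)" for x t
  have "continuous_on {0..l} p0"
    by (rule continuous_on_vector_derivative[OF p0])
  then have "cont_rect l T p"
    unfolding p_def by (intro cont_rect_add cont_rect_fst cont_rect_integral_t C1_rectD(1)[OF b])
  moreover have "((\<lambda>\<tau>. p x \<tau>) has_vector_derivative b x t) (at t within {0..T})"
    if "x \<in> {0..l}" "t \<in> {0..T}" for x t
    using integral_has_vector_derivative[OF cont_rect_slice_t[OF C1_rectD(1)[OF b] that(1)] that(2)]
    unfolding p_def by (auto intro!: derivative_eq_intros)
  moreover have "((\<lambda>\<xi>. p \<xi> t) has_vector_derivative a x t) (at x within {0..l})"
    if x: "x \<in> {0..l}" and t: "t \<in> {0..T}" for x t
  proof -
    have sub: "{0..t} \<subseteq> {0..T}" using t by auto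
    have "((\<lambda>\<xi>. integral (cbox 0 t) (b \<xi>)) has_vector_derivative integral (cbox 0 t) (bx x)) (at x within {0..l})"
    proof (rule leibniz_rule_vector_derivative)
      show "continuous_on ({0..l} \<times> cbox 0 t) (\<lambda>(x, t). bx x t)"
        by (rule continuous_on_subset[OF C1_rectD(2)[OF b]]) (use t in auto)
      show "b \<xi> integrable_on cbox 0 t" if "\<xi> \<in> {0..l}" for \<xi>
        unfolding box_real
        by (intro integrable_continuous_real continuous_on_subset[OF cont_rect_slice_t[OF C1_rectD(1)[OF b] that] sub])
    qed (use x t C1_rectD(4)[OF b] in auto)
    moreover have "(a' x has_integral a x t - a x 0) {0..t}"
    proof (rule fundamental_theorem_of_calculus)
      show "(a x has_vector_derivative a' x \<tau>) (at \<tau> within {0..t})" if "\<tau> \<in> {0..t}" for \<tau>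
        by (rule has_vector_derivative_within_subset[OF C1_rectD(5)[OF a x] sub]) (use that t in auto)
    qed (use t in auto)
    then have "(bx x has_integral a x t - a x 0) {0..t}"
      by (rule has_integral_eq[rotated]) (use x t compat in auto)
    ultimately have int: "((\<lambda>\<xi>. integral {0..t} (b \<xi>)) has_vector_derivative a x t - a x 0) (at x within {0..l})"
      by (simp add: integral_unique)
    show ?thesis
      unfolding p_def using has_vector_derivative_add[OF p0[OF x] int] by simp
  qed
  ultimately have "C1_rect l T p a b"
    using C1_rectD(1)[OF a] C1_rectD(1)[OF b] by (simp add: C1_rect_def)
  moreover have "p x 0 = p0 x" for x by (simp add: p_def)
  ultimately show thesis by (rule that)
qed

text \<open>
  The solution \<open>U\<close> of the evolution in \<open>t\<close> is compared with \<open>N x t = U 0 t + (\<integral>\<xi>=0..x. U \<xi> t ** k \<xi> t)\<close>: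
  by zero curvature, \<open>D = N - U\<close> satisfies the homogeneous linear equation
  \<open>\<partial>\<^sub>t D = D ** w - (\<integral>\<xi>=0..x. D ** \<partial>\<^sub>x w)\<close>. In this way the differentiability of \<open>U\<close> in the
  parameter \<open>x\<close> comes out without studying the dependence of solutions on parameters.
\<close>

lemma flat_frame_exists:
  fixes w k :: "real \<Rightarrow> real \<Rightarrow> real ^ 'n ^ 'n" and U0 :: "real \<Rightarrow> real ^ 'n ^ 'n"
  assumes w: "C1_rect l T w wx wt" and k: "C1_rect l T k kx kt"
    and compat: "\<And>x t. x \<in> {0..l} \<Longrightarrow> t \<in> {0..T} \<Longrightarrow>
      kt x t - wx x t = k x t ** w x t - w x t ** k x t"
    and U0: "\<And>x. x \<in> {0..l} \<Longrightarrow> (U0 has_vector_derivative U0 x ** k x 0) (at x within {0..l})"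
    and nonneg: "0 \<le> l" "0 \<le> T"
  obtains U where "C1_rect l T U (\<lambda>x t. U x t ** k x t) (\<lambda>x t. U x t ** w x t)"
    and "\<And>x. x \<in> {0..l} \<Longrightarrow> U x 0 = U0 x"
proof -
  note bil = bounded_bilinear_matrix_mult
  have U0_cont: "continuous_on {0..l} U0"
    by (rule continuous_on_vector_derivative[OF U0])
  obtain U where U: "cont_rect l T U" and U_init: "\<And>x. x \<in> {0..l} \<Longrightarrow> U x 0 = U0 x"
    and Ut: "\<And>x t. x \<in> {0..l} \<Longrightarrow> t \<in> {0..T} \<Longrightarrow>
      ((\<lambda>\<tau>. U x \<tau>) has_vector_derivative U x t ** w x t) (at t within {0..T})"
    using linear_ode_parameter_exists[OF bil C1_rectD(1)[OF w] U0_cont nonneg] by blast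
  have l0: "0 \<in> {0..l}" using nonneg by simp
  define P where "P x t = U x t ** k x t" for x t
  define Pt where "Pt x t = U x t ** kt x t + (U x t ** w x t) ** k x t" for x t
  define N where "N x t = U 0 t + integral {0..x} (\<lambda>\<xi>. P \<xi> t)" for x t
  define D where "D x t = N x t - U x t" for x t
  define D' where "D' x t = D x t ** w x t - integral {0..x} (\<lambda>\<xi>. D \<xi> t ** wx \<xi> t)" for x t
  have P: "cont_rect l T P"
    unfolding P_def by (intro cont_rect_bilinear[OF bil] U C1_rectD(1)[OF k])
  have Pt: "cont_rect l T Pt"
    unfolding Pt_def
    by (intro cont_rect_add cont_rect_bilinear[OF bil] U C1_rectD(1)[OF k] C1_rectD(3)[OF k] C1_rectD(1)[OF w])
  have P_deriv: "((\<lambda>\<tau>. P x \<tau>) has_vector_derivative Pt x t) (at t within {0..T})"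
    if "x \<in> {0..l}" "t \<in> {0..T}" for x t
    unfolding P_def Pt_def
    by (rule bounded_bilinear.has_vector_derivative[OF bil Ut[OF that] C1_rectD(5)[OF k that]])
  have N: "cont_rect l T N"
    unfolding N_def
    using cont_rect_swap[OF cont_rect_fst[OF cont_rect_slice_t[OF U l0], of l]]
    by (intro cont_rect_add cont_rect_integral_x P)
  have D: "cont_rect l T D"
    unfolding D_def by (intro cont_rect_diff N U)
  have Dwx: "cont_rect l T (\<lambda>x t. D x t ** wx x t)"
    by (intro cont_rect_bilinear[OF bil] D C1_rectD(2)[OF w])
  have Nx: "((\<lambda>\<xi>. N \<xi> t) has_vector_derivative P x t) (at x within {0..l})"
    if "x \<in> {0..l}" "t \<in> {0..T}" for x t
    using integral_has_vector_derivative[OF cont_rect_slice_x[OF P that(2)] that(1)]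
    unfolding N_def by (auto intro!: derivative_eq_intros)
  \<comment> \<open>Zero curvature turns \<open>Pt\<close> into \<open>U ** wx + P ** w\<close>.
    This cannot yet be called the x-derivative of \<open>U ** w\<close>, since \<open>U\<close> is
    not known to be differentiable in x. Writing \<open>U = N - D\<close> replaces it by the genuine
    derivative of \<open>N ** w\<close> and an error linear in \<open>D\<close>.\<close>
  have Pt_eq: "Pt x t = N x t ** wx x t + P x t ** w x t - D x t ** wx x t"
    if "x \<in> {0..l}" "t \<in> {0..T}" for x t
  proof -
    have "kt x t = wx x t + k x t ** w x t - w x t ** k x t"
      using compat[OF that] by (simp add: algebra_simps)
    then show ?thesis
      by (simp add: Pt_def P_def D_def bounded_bilinear.add_right[OF bil] bounded_bilinear.diff_right[OF bil]
          bounded_bilinear.diff_left[OF bil] matrix_mul_assoc)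
  qed
  have Dt: "((\<lambda>\<tau>. D x \<tau>) has_vector_derivative D' x t) (at t within {0..T})"
    if x: "x \<in> {0..l}" and t: "t \<in> {0..T}" for x t
  proof -
    have sub: "{0..x} \<subseteq> {0..l}" using x by auto
    have "((\<lambda>\<tau>. integral (cbox 0 x) (\<lambda>\<xi>. P \<xi> \<tau>)) has_vector_derivative integral (cbox 0 x) (\<lambda>\<xi>. Pt \<xi> t))
        (at t within {0..T})"
    proof (rule leibniz_rule_vector_derivative[where fx = "\<lambda>t \<xi>. Pt \<xi> t"])
      show "continuous_on ({0..T} \<times> cbox 0 x) (\<lambda>(t, \<xi>). Pt \<xi> t)"
        by (rule continuous_on_subset[OF cont_rect_swap[OF Pt]]) (use x in auto)
      show "(\<lambda>\<xi>. P \<xi> \<tau>) integrable_on cbox 0 x" if "\<tau> \<in> {0..T}" for \<tau>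
        unfolding box_real
        by (intro integrable_continuous_real continuous_on_subset[OF cont_rect_slice_x[OF P that] sub])
    qed (use x t P_deriv in auto)
    moreover have "((\<lambda>\<xi>. Pt \<xi> t) has_integral N x t ** w x t - N 0 t ** w 0 t - integral {0..x} (\<lambda>\<xi>. D \<xi> t ** wx \<xi> t)) {0..x}"
    proof -
      have 1: "((\<lambda>\<xi>. N \<xi> t ** wx \<xi> t + P \<xi> t ** w \<xi> t) has_integral N x t ** w x t - N 0 t ** w 0 t) {0..x}"
      proof (rule fundamental_theorem_of_calculus)
        fix \<xi> assume "\<xi> \<in> {0..x}"
        then have \<xi>: "\<xi> \<in> {0..l}" using x by auto
        show "((\<lambda>\<xi>. N \<xi> t ** w \<xi> t) has_vector_derivative N \<xi> t ** wx \<xi> t + P \<xi> t ** w \<xi> t) (at \<xi> within {0..x})"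
          by (rule has_vector_derivative_within_subset[OF _ sub],
              rule bounded_bilinear.has_vector_derivative[OF bil Nx[OF \<xi> t] C1_rectD(4)[OF w \<xi> t]])
      qed (use x in auto)
      have "(\<lambda>\<xi>. D \<xi> t ** wx \<xi> t) integrable_on {0..x}"
        by (intro integrable_continuous_real continuous_on_subset[OF cont_rect_slice_x[OF Dwx t] sub])
      from has_integral_diff[OF 1 integrable_integral[OF this]] show ?thesis
        by (rule has_integral_eq[rotated]) (use x t Pt_eq in auto)
    qed
    ultimately have "((\<lambda>\<tau>. integral {0..x} (\<lambda>\<xi>. P \<xi> \<tau>)) has_vector_derivative
        N x t ** w x t - N 0 t ** w 0 t - integral {0..x} (\<lambda>\<xi>. D \<xi> t ** wx \<xi> t)) (at t within {0..T})"
      by (simp add: integral_unique)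
    from has_vector_derivative_diff[OF has_vector_derivative_add[OF Ut[OF l0 t] this] Ut[OF x t]]
    have "((\<lambda>\<tau>. D x \<tau>) has_vector_derivative
        U 0 t ** w 0 t + (N x t ** w x t - N 0 t ** w 0 t - integral {0..x} (\<lambda>\<xi>. D \<xi> t ** wx \<xi> t)) - U x t ** w x t)
        (at t within {0..T})"
      unfolding D_def N_def .
    \<comment> \<open>Cancels the boundary term at \<open>\<xi> = 0\<close> against the time
      derivative of \<open>U 0 t\<close>, which leaves the homogeneous equation.\<close>
    moreover have "N 0 t = U 0 t" by (simp add: N_def)
    ultimately show ?thesis
      by (simp add: D'_def D_def[of x t] bounded_bilinear.diff_left[OF bil] algebra_simps)
  qed
  have D_init: "D x 0 = 0" if x: "x \<in> {0..l}" for x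
  proof -
    have sub: "{0..x} \<subseteq> {0..l}" using x by auto
    have "((\<lambda>\<xi>. U0 \<xi> ** k \<xi> 0) has_integral U0 x - U0 0) {0..x}"
    proof (rule fundamental_theorem_of_calculus)
      show "(U0 has_vector_derivative U0 \<xi> ** k \<xi> 0) (at \<xi> within {0..x})" if "\<xi> \<in> {0..x}" for \<xi>
        by (rule has_vector_derivative_within_subset[OF U0 sub]) (use that x in auto)
    qed (use x in auto)
    then have "((\<lambda>\<xi>. P \<xi> 0) has_integral U0 x - U0 0) {0..x}"
      by (rule has_integral_eq[rotated]) (use x U_init in \<open>auto simp: P_def\<close>)
    then show ?thesis
      using U_init x l0 by (simp add: D_def N_def integral_unique)
  qed
  obtain H where H: "0 < H" "\<And>(A :: real ^ 'n ^ 'n) (B :: real ^ 'n ^ 'n). norm (A ** B) \<le> norm A * norm B * H"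
    using bounded_bilinear.pos_bounded[OF bil] by blast
  obtain B where B: "0 < B" "\<And>x t. x \<in> {0..l} \<Longrightarrow> t \<in> {0..T} \<Longrightarrow> norm (w x t) \<le> B"
    using cont_rect_bound[OF C1_rectD(1)[OF w]] by blast
  obtain B' where B': "0 < B'" "\<And>x t. x \<in> {0..l} \<Longrightarrow> t \<in> {0..T} \<Longrightarrow> norm (wx x t) \<le> B'"
    using cont_rect_bound[OF C1_rectD(2)[OF w]] by blast
  have prod_le: "norm (A ** C) \<le> m * b * H" if "norm A \<le> m" "norm C \<le> b" for A C :: "real ^ 'n ^ 'n" and m b
  proof -
    have "norm A * norm C * H \<le> m * b * H"
      using that H(1) norm_ge_zero[of A] norm_ge_zero[of C]
      by (intro mult_right_mono mult_mono) linarith+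
    then show ?thesis using H(2)[of A C] by linarith
  qed
  \<comment> \<open>In the constant \<open>L\<close>, the first summand bounds \<open>D ** w\<close>
    and the second the integral over \<open>{0..x}\<close>, whose length is at most
    \<open>l\<close>.\<close>
  have D_zero: "D x t = 0" if "x \<in> {0..l}" "t \<in> {0..T}" for x t
  proof (rule gronwall_sup_zero[OF D D_init Dt, where L = "B * H + l * (B' * H)"])
    show "0 \<le> B * H + l * (B' * H)" using B B' H nonneg by simp
    fix x t m
    assume x: "x \<in> {0..l}" and t: "t \<in> {0..T}" and m: "\<And>\<xi>. \<xi> \<in> {0..l} \<Longrightarrow> norm (D \<xi> t) \<le> m"
    have m0: "0 \<le> m" using order_trans[OF norm_ge_zero m[OF x]] .
    have "norm (integral {0..x} (\<lambda>\<xi>. D \<xi> t ** wx \<xi> t)) \<le> integral {0..x} (\<lambda>\<xi>. m * B' * H)"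
    proof (rule integral_norm_bound_integral)
      show "(\<lambda>\<xi>. D \<xi> t ** wx \<xi> t) integrable_on {0..x}"
        by (intro integrable_continuous_real continuous_on_subset[OF cont_rect_slice_x[OF Dwx t]])
          (use x in auto)
      show "norm (D \<xi> t ** wx \<xi> t) \<le> m * B' * H" if "\<xi> \<in> {0..x}" for \<xi>
        using prod_le[OF m[of \<xi>] B'(2)[of \<xi> t]] that x t by simp
    qed (rule integrable_const_ivl)
    also have "\<dots> = x * (m * B' * H)" using x by simp
    also have "\<dots> \<le> l * (m * B' * H)"
      using x m0 B' H by (intro mult_right_mono) auto
    finally have "norm (integral {0..x} (\<lambda>\<xi>. D \<xi> t ** wx \<xi> t)) \<le> l * (m * B' * H)" .
    moreover have "norm (D x t ** w x t) \<le> m * B * H"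
      by (rule prod_le[OF m[OF x] B(2)[OF x t]])
    ultimately have "norm (D' x t) \<le> m * B * H + l * (m * B' * H)"
      unfolding D'_def by (intro norm_triangle_le_diff) linarith
    then show "norm (D' x t) \<le> (B * H + l * (B' * H)) * m"
      by (simp add: algebra_simps)
  qed (use that in auto)
  have Ux: "((\<lambda>\<xi>. U \<xi> t) has_vector_derivative P x t) (at x within {0..l})"
    if "x \<in> {0..l}" "t \<in> {0..T}" for x t
    by (rule has_vector_derivative_transform[OF that(1) _ Nx[OF that]])
      (use D_zero[OF _ that(2)] in \<open>simp add: D_def\<close>)
  have "C1_rect l T U P (\<lambda>x t. U x t ** w x t)"
    using U P Ux Ut cont_rect_bilinear[OF bil U C1_rectD(1)[OF w]] by (simp add: C1_rect_def)
  then show thesis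
    using that[of U] U_init unfolding P_def by blast
qed

section \<open>Block algebra, the intrinsic equations, and rotations\<close>

lemma stack_eq_iff: "stack a b = stack c d \<longleftrightarrow> a = c \<and> b = d"
  by (metis lower_stack upper_stack)

lemma stack_add: "stack a b + stack c d = stack (a + c) (b + d)"
  for a b :: "real ^ _"
  by (auto simp: stack_def vec_eq_iff split: sum.splits)

lemma stack_diff: "stack a b - stack c d = stack (a - c) (b - d)"
  for a b :: "real ^ _"
  by (auto simp: stack_def vec_eq_iff split: sum.splits)

lemma stack_minus: "- stack a b = stack (- a) (- b)"
  for a b :: "real ^ _"
  by (auto simp: stack_def vec_eq_iff split: sum.splits)

lemma stack_zero: "stack 0 0 = (0 :: real ^ _)"
  by (auto simp: stack_def vec_eq_iff split: sum.splits)

lemma stack_cases: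
  obtains a b where "u = stack a b"
  by (metis stack_upper_lower)

lemma bounded_linear_upper: "bounded_linear (upper :: real ^ ('m::finite + 'n::finite) \<Rightarrow> real ^ 'm)"
  unfolding linear_conv_bounded_linear[symmetric]
  by (auto intro!: linearI simp: upper_def vec_eq_iff)

lemma bounded_linear_lower: "bounded_linear (lower :: real ^ ('m::finite + 'n::finite) \<Rightarrow> real ^ 'n)"
  unfolding linear_conv_bounded_linear[symmetric]
  by (auto intro!: linearI simp: lower_def vec_eq_iff)

lemma C1_rect_stack:
  fixes f :: "real \<Rightarrow> real \<Rightarrow> real ^ 'm::finite" and g :: "real \<Rightarrow> real \<Rightarrow> real ^ 'n::finite"
  assumes "C1_rect l T f fx ft" "C1_rect l T g gx gt"
  shows "C1_rect l T (\<lambda>x t. stack (f x t) (g x t)) (\<lambda>x t. stack (fx x t) (gx x t)) (\<lambda>x t. stack (ft x t) (gt x t))"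
proof -
  have "bounded_linear (\<lambda>a :: real ^ 'm. stack a (0 :: real ^ 'n))" "bounded_linear (\<lambda>b :: real ^ 'n. stack (0 :: real ^ 'm) b)"
    unfolding linear_conv_bounded_linear[symmetric]
    by (auto intro!: linearI simp: stack_def vec_eq_iff split: sum.splits)
  from C1_rect_add[OF C1_rect_linear[OF this(1) assms(1)] C1_rect_linear[OF this(2) assms(2)]]
  show ?thesis by (simp add: stack_add)
qed

section \<open>Vectors as skew-symmetric matrices\<close>

lemma bounded_linear_hat: "bounded_linear hat"
  unfolding linear_conv_bounded_linear[symmetric]
  by (auto intro!: linearI simp: hat_def matrix_def cross3_def vec_eq_iff forall_3 algebra_simps)

lemma bounded_linear_axial: "bounded_linear axial"
  unfolding linear_conv_bounded_linear[symmetric]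
  by (auto intro!: linearI simp: axial_def vec_eq_iff forall_3 algebra_simps)

lemma bounded_linear_transpose:
  "bounded_linear (transpose :: real ^ 'n ^ 'm \<Rightarrow> real ^ 'm ^ 'n)"
  unfolding linear_conv_bounded_linear[symmetric]
  by (auto intro!: linearI simp: transpose_def vec_eq_iff)

lemma transpose_hat: "transpose (hat u) = - hat u"
  by (simp add: transpose_def hat_def matrix_def cross3_def axis_def vec_eq_iff forall_3)

lemma hat_eq_iff: "hat u = hat v \<longleftrightarrow> u = v"
  by (metis axial_hat)

lemma hat_zero: "hat 0 = 0"
  by (rule linear_0[OF bounded_linear.linear[OF bounded_linear_hat]])

lemma hat_add: "hat (u + v) = hat u + hat v"
  by (rule linear_add[OF bounded_linear.linear[OF bounded_linear_hat]])

text \<open>Links the matrix form of zero curvature with the cross products of the intrinsic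
  equations. Evaluated on a vector, it is the Jacobi identity for \<open>cross3\<close>.\<close>

lemma hat_cross: "hat (cross3 u v) = hat u ** hat v - hat v ** hat u"
proof -
  have "hat (cross3 u v) *v z = (hat u ** hat v - hat v ** hat u) *v z" for z
    by (simp add: bounded_bilinear.diff_left[OF bounded_bilinear_matrix_vector_mult]
        matrix_vector_mul_assoc[symmetric] hat_mult_vec)
      (simp add: cross3_def vec_eq_iff forall_3 algebra_simps)
  then show ?thesis by (simp add: matrix_eq)
qed

lemma block_diag_mult_stack:
  fixes A :: "real ^ 'n::finite ^ 'm::finite" and D :: "real ^ 'q::finite ^ 'p::finite"
  shows "block_diag A D *v stack a b = stack (A *v a) (D *v b)"
  by (simp add: block_diag_def block_mat_mult_stack)

lemma block_diag_mult:
  fixes A :: "real ^ 'n::finite ^ 'm::finite" and D :: "real ^ 'q::finite ^ 'p::finite"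
  shows "block_diag A D *v u = stack (A *v upper u) (D *v lower u)"
  using block_diag_mult_stack[of A D "upper u" "lower u"] by simp

lemma transpose_block_mat:
  "transpose (block_mat A B C D) = block_mat (transpose A) (transpose C) (transpose B) (transpose D)"
  by (auto simp: transpose_def block_mat_def stack_def vec_eq_iff split: sum.splits)

lemma invertible_iff_ker:
  fixes A :: "real ^ 'n ^ 'n"
  shows "invertible A \<longleftrightarrow> (\<forall>u. A *v u = 0 \<longrightarrow> u = 0)"
  by (simp add: invertible_left_inverse matrix_left_invertible_ker)

lemma sym_pos_def_invertible: "sym_pos_def A \<Longrightarrow> invertible A"
  unfolding invertible_iff_ker sym_pos_def_def by (metis inner_zero_right less_irrefl)

lemma invertible_block_diag:
  fixes A :: "real ^ 'n::finite ^ 'n" and D :: "real ^ 'q::finite ^ 'q"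
  assumes "invertible A" "invertible D"
  shows "invertible (block_diag A D)"
  unfolding invertible_iff_ker
proof (intro allI impI)
  fix u assume 0: "block_diag A D *v u = 0"
  obtain a b where u: "u = stack a b" by (rule stack_cases)
  have "A *v a = 0" "D *v b = 0"
    using 0 by (simp_all add: u block_diag_mult_stack stack_zero[symmetric] stack_eq_iff)
  then have "a = 0" "b = 0" using assms unfolding invertible_iff_ker by blast+
  then show "u = 0" by (simp add: u stack_zero)
qed

lemma matrix_inv_cancel:
  assumes "invertible A"
  shows "A *v (matrix_inv A *v u) = u" "matrix_inv A *v (A *v u) = u"
  by (simp_all add: matrix_vector_mul_assoc matrix_inv_left matrix_inv_right assms)

lemma minus_matrix_vector_mult: "(- A) *v u = - (A *v u)" for A :: "real ^ 'n ^ 'm"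
  by (rule bounded_bilinear.minus_left[OF bounded_bilinear_matrix_vector_mult])

text \<open>
  The first pair of equations is the balance of momenta in the moving frame, the second pair the
  integrability condition for the frame with strains \<open>\<kappa>\<close>, \<open>\<epsilon>\<close> and velocities \<open>upper u\<close>.
\<close>

lemma intrinsic_pde_iff:
  assumes inv: "invertible (M x)" "invertible (C x)"
    and m: "m = M x *v upper u" "mt = M x *v upper ut"
    and s: "s = C x *v lower u" "st = C x *v lower ut"
    and \<kappa>: "\<kappa> = lower s + curvature l R x" and \<epsilon>: "\<epsilon> = upper s + e1"
  shows "ut + Amat M C x *v ux + Bmat l M C R x *v u = gbar M C x u \<longleftrightarrow>
    (upper mt + cross3 (lower (upper u)) (upper m) =
       upper (lower ux) + cross3 \<kappa> (upper (lower u)) \<and>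
     lower mt + cross3 (lower (upper u)) (lower m) + cross3 (upper (upper u)) (upper m) =
       lower (lower ux) + cross3 \<kappa> (lower (lower u)) + cross3 \<epsilon> (upper (lower u))) \<and>
    (upper st = upper (upper ux) + cross3 \<kappa> (upper (upper u)) + cross3 \<epsilon> (lower (upper u)) \<and>
     lower st = lower (upper ux) + cross3 \<kappa> (lower (upper u)))"
proof -
  obtain u1 u2 u3 u4 where u: "u = stack (stack u1 u2) (stack u3 u4)" by (metis stack_cases)
  obtain x1 x2 x3 x4 where ux: "ux = stack (stack x1 x2) (stack x3 x4)" by (metis stack_cases)
  obtain vt zt where ut: "ut = stack vt zt" by (metis stack_cases)
  obtain m1 m2 where m12: "m = stack m1 m2" by (metis stack_cases)
  obtain s1 s2 where s12: "s = stack s1 s2" by (metis stack_cases)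
  obtain a1 a2 where mt12: "mt = stack a1 a2" by (metis stack_cases)
  obtain b1 b2 where st12: "st = stack b1 b2" by (metis stack_cases)
  have Mu: "M x *v stack u1 u2 = stack m1 m2" using m m12 by (simp add: u)
  have Mt: "M x *v vt = stack a1 a2" using m mt12 by (simp add: ut)
  have Cu: "C x *v stack u3 u4 = stack s1 s2" using s s12 by (simp add: u)
  have Ct: "C x *v zt = stack b1 b2" using s st12 by (simp add: ut)
  let ?Q = "QP M C x"
  have Q: "invertible ?Q"
    unfolding QP_def by (rule invertible_block_diag[OF inv])
  \<comment> \<open>Multiplication by the invertible \<open>QP\<close> removes every inverse matrix
    from the equation.\<close>
  have "ut + Amat M C x *v ux + Bmat l M C R x *v u = gbar M C x u \<longleftrightarrow>
      ?Q *v (ut + Amat M C x *v ux + Bmat l M C R x *v u) = ?Q *v gbar M C x u"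
    using matrix_inv_cancel(2)[OF Q] by metis
  also have "?Q *v gbar M C x u = Gmat u *v (?Q *v u)"
    by (simp add: gbar_def matrix_inv_cancel[OF Q])
  also have "?Q *v (ut + Amat M C x *v ux + Bmat l M C R x *v u) =
      ?Q *v ut - block_mat 0 (mat 1) (mat 1) 0 *v ux +
      block_mat 0 (- Emat l R x) (transpose (Emat l R x)) 0 *v u"
    by (simp add: Amat_def Bmat_def matrix_vector_right_distrib minus_matrix_vector_mult
        bounded_bilinear.minus_right[OF bounded_bilinear_matrix_vector_mult]
        bounded_bilinear.diff_right[OF bounded_bilinear_matrix_vector_mult]
        matrix_vector_mul_assoc[symmetric] matrix_inv_cancel[OF Q])
  also have "\<dots> = Gmat u *v (?Q *v u) \<longleftrightarrow>
      (a1 - x3 - cross3 (curvature l R x) u3 = - (cross3 u2 m1 + cross3 u3 s2) \<and>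
       a2 - x4 + (- cross3 e1 u3 - cross3 (curvature l R x) u4) =
         - (cross3 u1 m1 + cross3 u2 m2 + (cross3 u3 s1 + cross3 u4 s2))) \<and>
      (b1 - x1 + (- cross3 (curvature l R x) u1 - cross3 e1 u2) = - (cross3 u2 s1 + cross3 u1 s2) \<and>
       b2 - x2 - cross3 (curvature l R x) u2 = - cross3 u2 s2)"
    by (simp add: Gmat_def Let_def QP_def Emat_def u ux ut block_diag_mult_stack block_mat_mult_stack
        Mu Mt Cu Ct transpose_block_mat transpose_hat minus_matrix_vector_mult hat_mult_vec
        stack_add stack_diff stack_minus stack_eq_iff)
  \<comment> \<open>By antisymmetry of \<open>cross3\<close>, the quadratic terms with
    \<open>s1\<close> and \<open>s2\<close> merge with the linear terms in \<open>e1\<close> and the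
    curvature; the sums are exactly \<epsilon> and \<kappa>.\<close>
  also have "\<dots> \<longleftrightarrow>
     (a1 + cross3 u2 m1 = x3 + cross3 \<kappa> u3 \<and>
      a2 + cross3 u2 m2 + cross3 u1 m1 = x4 + cross3 \<kappa> u4 + cross3 \<epsilon> u3) \<and>
     (b1 = x1 + cross3 \<kappa> u1 + cross3 \<epsilon> u2 \<and> b2 = x2 + cross3 \<kappa> u2)"
    unfolding \<kappa> \<epsilon> s12
    by (simp add: cross_add_left cross_skew[of u3] cross_skew[of u4] cross_skew[of u2 s1] 
        cross_skew[of u1 s2] cross_skew[of u2 s2] algebra_simps eq_diff_eq diff_eq_eq)
  finally show ?thesis
    by (simp add: u ux m12 s12 mt12 st12)
qed

section \<open>Orthogonal frames along a curve\<close>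

lemma orthogonal_cancel:
  assumes "orthogonal_matrix (U :: real ^ 'n ^ 'n)"
  shows "transpose U *v (U *v u) = u" "U *v (transpose U *v u) = u"
    "transpose U ** (U ** A) = A" "U ** (transpose U ** A) = A"
  using assms
  by (simp_all add: orthogonal_matrix_def matrix_vector_mul_assoc matrix_mul_assoc
      del: transpose_matrix_vector)

lemma orthogonal_inj:
  assumes "orthogonal_matrix (U :: real ^ 'n ^ 'n)"
  shows "U *v u = U *v v \<longleftrightarrow> u = v" "U ** A = U ** B \<longleftrightarrow> A = B"
  by (metis orthogonal_cancel(1,3)[OF assms])+

text \<open>Differentiating \<open>transpose U ** U = mat 1\<close> shows that
  \<open>transpose U ** U'\<close> is skew-symmetric, so \<open>axial\<close> followed by
  \<open>hat\<close> loses nothing.\<close>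

lemma frame_derivative:
  fixes U :: "real \<Rightarrow> real ^ 3 ^ 3"
  assumes U: "(U has_vector_derivative U') (at x within {0..l})" and x: "0 < l" "x \<in> {0..l}"
    and orth: "\<And>\<xi>. \<xi> \<in> {0..l} \<Longrightarrow> orthogonal_matrix (U \<xi>)"
  shows "U' = U x ** hat (axial (transpose (U x) ** U'))"
proof -
  have "((\<lambda>\<xi>. transpose (U \<xi>) ** U \<xi>) has_vector_derivative
      transpose (U x) ** U' + transpose U' ** U x) (at x within {0..l})"
    by (intro bounded_bilinear.has_vector_derivative[OF bounded_bilinear_matrix_mult]
        bounded_linear.has_vector_derivative[OF bounded_linear_transpose] U)
  moreover have "((\<lambda>\<xi>. transpose (U \<xi>) ** U \<xi>) has_vector_derivative 0) (at x within {0..l})"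
    by (rule has_vector_derivative_transform[OF x(2) _ has_vector_derivative_const[of "mat 1"]])
      (use orth in \<open>simp add: orthogonal_matrix_def\<close>)
  ultimately have "transpose (U x) ** U' + transpose U' ** U x = 0"
    using vector_derivative_unique_within_closed_interval[of 0 l x "\<lambda>\<xi>. transpose (U \<xi>) ** U \<xi>"] x
    by simp
  then have "transpose (transpose (U x) ** U') = - (transpose (U x) ** U')"
    by (simp add: matrix_transpose_mul transpose_transpose eq_neg_iff_add_eq_0 add.commute)
  then show ?thesis
    by (simp add: hat_axial orthogonal_cancel[OF orth[OF x(2)]])
qed

text \<open>The derivative is \<open>U ** (hat w + transpose (hat w)) ** transpose V\<close>, which
  vanishes by skew symmetry. The case \<open>V = U\<close> gives conservation of orthogonality, two
  different frames give uniqueness.\<close>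

lemma frame_product_const:
  fixes U V :: "real \<Rightarrow> real ^ 3 ^ 3"
  assumes U: "\<And>t. t \<in> {0..T} \<Longrightarrow> (U has_vector_derivative U t ** hat (w t)) (at t within {0..T})"
    and V: "\<And>t. t \<in> {0..T} \<Longrightarrow> (V has_vector_derivative V t ** hat (w t)) (at t within {0..T})"
    and t: "t \<in> {0..T}"
  shows "U t ** transpose (V t) = U 0 ** transpose (V 0)"
proof -
  have "((\<lambda>t. U t ** transpose (V t)) has_vector_derivative 0) (at \<tau> within {0..T})" if "\<tau> \<in> {0..T}" for \<tau>
  proof -
    have "((\<lambda>t. U t ** transpose (V t)) has_vector_derivative
      U \<tau> ** transpose (V \<tau> ** hat (w \<tau>)) + (U \<tau> ** hat (w \<tau>)) ** transpose (V \<tau>)) (at \<tau> within {0..T})"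
      by (intro bounded_bilinear.has_vector_derivative[OF bounded_bilinear_matrix_mult]
          bounded_linear.has_vector_derivative[OF bounded_linear_transpose] U V that)
    moreover have "U \<tau> ** transpose (V \<tau> ** hat (w \<tau>)) + (U \<tau> ** hat (w \<tau>)) ** transpose (V \<tau>) = 0"
      by (simp add: matrix_transpose_mul transpose_hat matrix_mul_assoc
          bounded_bilinear.minus_left[OF bounded_bilinear_matrix_mult]
          bounded_bilinear.minus_right[OF bounded_bilinear_matrix_mult])
    ultimately show ?thesis by simp
  qed
  then obtain c where "\<And>\<tau>. \<tau> \<in> {0..T} \<Longrightarrow> U \<tau> ** transpose (V \<tau>) = c"
    by (rule has_vector_derivative_zero_constant[of "{0..T}", rotated]) simp_all
  then show ?thesis using t by simp
qed

text \<open>Orthogonality is conserved, so the determinant is 1 or -1 at all times. It is continuous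
  and starts at 1, and it would have to pass through 0 to reach -1.\<close>

lemma frame_rotation:
  fixes U :: "real \<Rightarrow> real ^ 3 ^ 3"
  assumes U: "\<And>t. t \<in> {0..T} \<Longrightarrow> (U has_vector_derivative U t ** hat (w t)) (at t within {0..T})"
    and U0: "rotation_matrix (U 0)" and t: "t \<in> {0..T}"
  shows "rotation_matrix (U t)"
proof -
  have orth: "orthogonal_matrix (U \<tau>)" if "\<tau> \<in> {0..T}" for \<tau>
    using frame_product_const[OF U U that] U0
    by (auto simp: rotation_matrix_def orthogonal_matrix_def matrix_left_right_inverse)
  have "continuous_on {0..T} U"
    by (rule continuous_on_vector_derivative[OF U])
  then have cont: "continuous_on {0..t} (\<lambda>\<tau>. det (U \<tau>))"
    by (intro continuous_on_det) (rule continuous_on_subset, use t in auto)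
  have "det (U t) \<noteq> - 1"
  proof
    assume "det (U t) = - 1"
    then obtain \<tau> where "0 \<le> \<tau>" "\<tau> \<le> t" "det (U \<tau>) = 0"
      using IVT2'[OF _ _ _ cont, of 0] U0 t by (auto simp: rotation_matrix_def)
    then show False using det_orthogonal_matrix[OF orth, of \<tau>] t by auto
  qed
  then show ?thesis
    using det_orthogonal_matrix[OF orth[OF t]] orth[OF t] by (simp add: rotation_matrix_def)
qed

lemma frame_unique:
  fixes U V :: "real \<Rightarrow> real ^ 3 ^ 3"
  assumes U: "\<And>t. t \<in> {0..T} \<Longrightarrow> (U has_vector_derivative U t ** hat (w t)) (at t within {0..T})"
    and V: "\<And>t. t \<in> {0..T} \<Longrightarrow> (V has_vector_derivative V t ** hat (w t)) (at t within {0..T})"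
    and orth: "\<And>t. t \<in> {0..T} \<Longrightarrow> orthogonal_matrix (V t)" and init: "U 0 = V 0"
    and t: "t \<in> {0..T}"
  shows "U t = V t"
proof -
  have 0: "0 \<in> {0..T}" using t by simp
  have "U t ** transpose (V t) = mat 1"
    using frame_product_const[OF U V t] orth[OF 0] init by (simp add: orthogonal_matrix_def)
  then have "U t ** transpose (V t) ** V t = mat 1 ** V t" by simp
  then show ?thesis
    using orth[OF t] by (simp add: matrix_mul_assoc[symmetric] orthogonal_matrix_def)
qed

section \<open>Moving frames\<close>

text \<open>The \<kappa> of the overview, and \<open>stretching\<close> is its \<epsilon>: the
  definition of \<open>stress\<close> solved for the strains of the deformed beam, with those of the
  reference configuration added back.\<close>

definition bending ::
  "real \<Rightarrow> (real \<Rightarrow> mat6) \<Rightarrow> (real \<Rightarrow> real ^ 3 ^ 3) \<Rightarrow> (real \<Rightarrow> real \<Rightarrow> real12) \<Rightarrow> real \<Rightarrow> real \<Rightarrow> real ^ 3" where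
  "bending l C R y x t = lower (C x *v lower (y x t)) + curvature l R x"

definition stretching ::
  "(real \<Rightarrow> mat6) \<Rightarrow> (real \<Rightarrow> real \<Rightarrow> real12) \<Rightarrow> real \<Rightarrow> real \<Rightarrow> real ^ 3" where
  "stretching C y x t = upper (C x *v lower (y x t)) + e1"

text \<open>The notion through which both directions pass: first-order equations for
  \<open>U\<close> and \<open>p\<close> whose coefficients are read off \<open>y\<close>. It
  contains neither the balance laws nor any initial or boundary data.\<close>

definition moving_frame ::
  "real \<Rightarrow> real \<Rightarrow> (real \<Rightarrow> mat6) \<Rightarrow> (real \<Rightarrow> real ^ 3 ^ 3) \<Rightarrow> (real \<Rightarrow> real \<Rightarrow> real12) \<Rightarrow>
   (real \<Rightarrow> real \<Rightarrow> real ^ 3) \<Rightarrow> (real \<Rightarrow> real \<Rightarrow> real ^ 3 ^ 3) \<Rightarrow> bool" where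
  "moving_frame l T C R y p U \<longleftrightarrow>
     C1_rect l T U (\<lambda>x t. U x t ** hat (bending l C R y x t)) (\<lambda>x t. U x t ** hat (lower (upper (y x t)))) \<and>
     C1_rect l T p (\<lambda>x t. U x t *v stretching C y x t) (\<lambda>x t. U x t *v upper (upper (y x t))) \<and>
     (\<forall>x\<in>{0..l}. \<forall>t\<in>{0..T}. rotation_matrix (U x t))"

text \<open>The field equations of \<open>solves_GEB\<close> at a single point, set apart so that
  one pointwise equivalence serves both directions.\<close>

definition momentum_balance ::
  "real \<Rightarrow> real \<Rightarrow> (real \<Rightarrow> mat6) \<Rightarrow> (real \<Rightarrow> mat6) \<Rightarrow> (real \<Rightarrow> real ^ 3 ^ 3) \<Rightarrow>
   (real \<Rightarrow> real \<Rightarrow> real ^ 3) \<Rightarrow> (real \<Rightarrow> real \<Rightarrow> real ^ 3 ^ 3) \<Rightarrow> real \<Rightarrow> real \<Rightarrow> bool" where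
  "momentum_balance l T M C R p U x t \<longleftrightarrow>
    (let v = velocity T p U;
         z = stress l C R p U;
         a = (\<lambda>x t. upper (block_diag (U x t) (U x t) *v (M x *v v x t)));
         b = (\<lambda>x t. lower (block_diag (U x t) (U x t) *v (M x *v v x t)));
         \<phi> = (\<lambda>x t. upper (block_diag (U x t) (U x t) *v z x t));
         \<psi> = (\<lambda>x t. lower (block_diag (U x t) (U x t) *v z x t))
     in Dt T a x t = Dx l \<phi> x t \<and>
        cross3 (Dt T p x t) (a x t) + Dt T b x t = cross3 (Dx l p x t) (\<phi> x t) + Dx l \<psi> x t)"

text \<open>Differentiation of a rotated vector leaves \<open>U\<close> as a common factor, at the
  cost of a cross product with the rate of rotation. This is the source of the cross products in the
  intrinsic equations.\<close>

lemma C1_rect_rotated: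
  fixes U :: "real \<Rightarrow> real \<Rightarrow> real ^ 3 ^ 3" and f :: "real \<Rightarrow> real \<Rightarrow> real ^ 3"
  assumes "C1_rect l T U (\<lambda>x t. U x t ** hat (k x t)) (\<lambda>x t. U x t ** hat (w x t))"
    and "C1_rect l T f fx ft"
  shows "C1_rect l T (\<lambda>x t. U x t *v f x t) (\<lambda>x t. U x t *v (fx x t + cross3 (k x t) (f x t)))
           (\<lambda>x t. U x t *v (ft x t + cross3 (w x t) (f x t)))"
  by (rule C1_rect_cong[OF C1_rect_bilinear[OF bounded_bilinear_matrix_vector_mult assms]])
    (simp_all add: matrix_vector_right_distrib matrix_vector_mul_assoc[symmetric] hat_mult_vec)

text \<open>Uniqueness for the intrinsic system identifies solutions on the closed rectangle only;
  this allows one to be exchanged for another there.\<close>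

lemma moving_frame_cong:
  assumes mf: "moving_frame l T C R y p U"
    and y: "\<And>x t. x \<in> {0..l} \<Longrightarrow> t \<in> {0..T} \<Longrightarrow> y' x t = y x t"
  shows "moving_frame l T C R y' p U"
  using mf unfolding moving_frame_def
  by (auto elim!: C1_rect_cong simp: bending_def stretching_def y)

lemma moving_frameD:
  assumes "moving_frame l T C R y p U"
  shows "C1_rect l T U (\<lambda>x t. U x t ** hat (bending l C R y x t)) (\<lambda>x t. U x t ** hat (lower (upper (y x t))))"
    and "C1_rect l T p (\<lambda>x t. U x t *v stretching C y x t) (\<lambda>x t. U x t *v upper (upper (y x t)))"
    and "\<And>x t. x \<in> {0..l} \<Longrightarrow> t \<in> {0..T} \<Longrightarrow> rotation_matrix (U x t)"
    and "\<And>x t. x \<in> {0..l} \<Longrightarrow> t \<in> {0..T} \<Longrightarrow> orthogonal_matrix (U x t)"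
  using assms by (auto simp: moving_frame_def rotation_matrix_def)

lemma moving_frame_unique:
  assumes "moving_frame l T C R y p U" "moving_frame l T C R y p' U'"
    and init: "U' x 0 = U x 0" "p' x 0 = p x 0"
    and x: "x \<in> {0..l}" and t: "t \<in> {0..T}"
  shows "U' x t = U x t" "p' x t = p x t"
proof -
  have U: "((\<lambda>\<tau>. U x \<tau>) has_vector_derivative U x \<tau> ** hat (lower (upper (y x \<tau>)))) (at \<tau> within {0..T})"
    and p: "((\<lambda>\<tau>. p x \<tau>) has_vector_derivative U x \<tau> *v upper (upper (y x \<tau>))) (at \<tau> within {0..T})"
    and U': "((\<lambda>\<tau>. U' x \<tau>) has_vector_derivative U' x \<tau> ** hat (lower (upper (y x \<tau>)))) (at \<tau> within {0..T})"
    and p': "((\<lambda>\<tau>. p' x \<tau>) has_vector_derivative U' x \<tau> *v upper (upper (y x \<tau>))) (at \<tau> within {0..T})"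
    and rot: "orthogonal_matrix (U x \<tau>)"
    if "\<tau> \<in> {0..T}" for \<tau>
    using C1_rectD(5)[OF moving_frameD(1)[OF assms(1)] x that]
      C1_rectD(5)[OF moving_frameD(2)[OF assms(1)] x that]
      C1_rectD(5)[OF moving_frameD(1)[OF assms(2)] x that]
      C1_rectD(5)[OF moving_frameD(2)[OF assms(2)] x that] moving_frameD(4)[OF assms(1) x that]
    by simp_all
  have eq: "U' x \<tau> = U x \<tau>" if "\<tau> \<in> {0..T}" for \<tau>
    by (rule frame_unique[OF U' U rot init(1) that])
  then show "U' x t = U x t" using t .
  have "((\<lambda>\<tau>. p' x \<tau> - p x \<tau>) has_vector_derivative 0) (at \<tau> within {0..T})" if "\<tau> \<in> {0..T}" for \<tau>
    using has_vector_derivative_diff[OF p'[OF that] p[OF that]] eq[OF that] by simp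
  then obtain c where "\<And>\<tau>. \<tau> \<in> {0..T} \<Longrightarrow> p' x \<tau> - p x \<tau> = c"
    by (rule has_vector_derivative_zero_constant[of "{0..T}", rotated]) simp_all
  from this[of 0] this[of t] show "p' x t = p x t"
    using init t by simp
qed

section \<open>Regularity of the strains and pointwise equivalence of the two systems\<close>

locale beam =
  fixes l T :: real and M C :: "real \<Rightarrow> mat6" and R :: "real \<Rightarrow> real ^ 3 ^ 3"
  assumes l_pos: "0 < l" and T_pos: "0 < T"
    and M_C1: "Ck_seg 1 l M" and M_inv: "\<And>x. x \<in> {0..l} \<Longrightarrow> invertible (M x)"
    and C_C1: "Ck_seg 1 l C" and C_inv: "\<And>x. x \<in> {0..l} \<Longrightarrow> invertible (C x)"
    and R_C2: "Ck_seg 2 l R"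
begin

lemma C1_rect_M: "C1_rect l T (\<lambda>x t. M x) (\<lambda>x t. Dseg l M x) (\<lambda>x t. 0)"
  by (rule C1_rect_seg[OF Ck_seg_1D(2,3)[OF M_C1]])

lemma C1_rect_C: "C1_rect l T (\<lambda>x t. C x) (\<lambda>x t. Dseg l C x) (\<lambda>x t. 0)"
  by (rule C1_rect_seg[OF Ck_seg_1D(2,3)[OF C_C1]])

text \<open>Makes the stress of a C^2 motion a C^1 function, as an intrinsic solution has to
  be.\<close>

lemma C1_rect_C_inv:
  "C1_rect l T (\<lambda>x t. matrix_inv (C x)) (\<lambda>x t. - (matrix_inv (C x) ** Dseg l C x ** matrix_inv (C x))) (\<lambda>x t. 0)"
proof (rule C1_rect_seg)
  note C = Ck_seg_1D[OF C_C1]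
  show "continuous_on {0..l} (\<lambda>x. - (matrix_inv (C x) ** Dseg l C x ** matrix_inv (C x)))"
    by (intro continuous_on_minus bounded_bilinear.continuous_on[OF bounded_bilinear_matrix_mult]
        continuous_on_matrix_inv C C_inv)
  show "((\<lambda>x. matrix_inv (C x)) has_vector_derivative - (matrix_inv (C x) ** Dseg l C x ** matrix_inv (C x)))
      (at x within {0..l})" if "x \<in> {0..l}" for x
    by (rule has_vector_derivative_matrix_inv[OF C(3)[OF that] that C(1) C_inv])
qed

text \<open>The curvature contains one derivative of \<open>R\<close>, so class C^2 of
  \<open>R\<close> makes it C^1. Its x-derivative stays existential: the compatibility conditions
  involve the strains only through their values and time derivatives.\<close>

lemma C1_rect_curvature: "\<exists>R'. C1_rect l T (\<lambda>x t. curvature l R x) R' (\<lambda>x t. 0)"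
proof -
  note R = Ck_seg_2D[OF R_C2]
  note R0 = C1_rect_seg[OF Ck_seg_1D(2,3)[OF R(1)]]
  note R1 = C1_rect_seg[OF Ck_seg_1D(2,3)[OF R(2)]]
  note C1 = C1_rect_linear[OF bounded_linear_axial C1_rect_bilinear[OF bounded_bilinear_matrix_mult
        C1_rect_linear[OF bounded_linear_transpose R0] R1]]
  show ?thesis
    by (rule exI, rule C1_rect_cong[OF C1[of T] _ refl])
      (auto simp: curvature_def transpose_def matrix_matrix_mult_def axial_def vec_eq_iff forall_3)
qed

lemma C1_rect_strain:
  assumes "C1_rect l T y yx yt"
  shows "\<exists>sx. C1_rect l T (\<lambda>x t. C x *v lower (y x t)) sx (\<lambda>x t. C x *v lower (yt x t))"
  by (rule exI, rule C1_rect_cong[OF C1_rect_bilinear[OF bounded_bilinear_matrix_vector_mult C1_rect_C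
          C1_rect_linear[OF bounded_linear_lower assms]]]) simp_all

lemma C1_rect_bending:
  assumes "C1_rect l T y yx yt"
  shows "\<exists>kx. C1_rect l T (bending l C R y) kx (\<lambda>x t. lower (C x *v lower (yt x t)))"
proof -
  obtain sx where s: "C1_rect l T (\<lambda>x t. C x *v lower (y x t)) sx (\<lambda>x t. C x *v lower (yt x t))"
    using C1_rect_strain[OF assms] by blast
  obtain R' where c: "C1_rect l T (\<lambda>x t. curvature l R x) R' (\<lambda>x t. 0)"
    using C1_rect_curvature by blast
  show ?thesis
    by (rule exI, rule C1_rect_cong[OF C1_rect_add[OF C1_rect_linear[OF bounded_linear_lower s] c]])
      (simp_all add: bending_def)
qed

lemma C1_rect_stretching:
  assumes "C1_rect l T y yx yt"
  shows "\<exists>ex. C1_rect l T (stretching C y) ex (\<lambda>x t. upper (C x *v lower (yt x t)))"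
proof -
  obtain sx where s: "C1_rect l T (\<lambda>x t. C x *v lower (y x t)) sx (\<lambda>x t. C x *v lower (yt x t))"
    using C1_rect_strain[OF assms] by blast
  show ?thesis
    by (rule exI, rule C1_rect_cong[OF C1_rect_add[OF C1_rect_linear[OF bounded_linear_upper s] C1_rect_const[of l T e1]]])
      (simp_all add: stretching_def)
qed

lemma C1_rect_velocities:
  fixes y :: "real \<Rightarrow> real \<Rightarrow> real12"
  assumes "C1_rect l T y yx yt"
  shows "C1_rect l T (\<lambda>x t. upper (upper (y x t))) (\<lambda>x t. upper (upper (yx x t))) (\<lambda>x t. upper (upper (yt x t)))"
    and "C1_rect l T (\<lambda>x t. lower (upper (y x t))) (\<lambda>x t. lower (upper (yx x t))) (\<lambda>x t. lower (upper (yt x t)))"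
  by (rule C1_rect_linear[OF bounded_linear_upper C1_rect_linear[OF bounded_linear_upper assms]]
      C1_rect_linear[OF bounded_linear_lower C1_rect_linear[OF bounded_linear_upper assms]])+

text \<open>The mixed derivatives of \<open>U\<close> and of \<open>p\<close> coincide; cancelling
  the orthogonal factor \<open>U\<close> expresses this in the body frame. Hence every moving frame
  satisfies the last six intrinsic equations, whether or not the balance laws hold.\<close>

lemma moving_frame_compatible:
  assumes y: "C1_rect l T y yx yt" and mf: "moving_frame l T C R y p U"
    and xt: "x \<in> {0..l}" "t \<in> {0..T}"
  shows "upper (C x *v lower (yt x t)) = upper (upper (yx x t)) +
      cross3 (bending l C R y x t) (upper (upper (y x t))) + cross3 (stretching C y x t) (lower (upper (y x t)))"
    and "lower (C x *v lower (yt x t)) = lower (upper (yx x t)) +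
      cross3 (bending l C R y x t) (lower (upper (y x t)))"
proof -
  note U = moving_frameD(1)[OF mf] and p = moving_frameD(2)[OF mf]
    and orth = moving_frameD(4)[OF mf xt]
  obtain kx where k: "C1_rect l T (bending l C R y) kx (\<lambda>x t. lower (C x *v lower (yt x t)))"
    using C1_rect_bending[OF y] by blast
  obtain ex where e: "C1_rect l T (stretching C y) ex (\<lambda>x t. upper (C x *v lower (yt x t)))"
    using C1_rect_stretching[OF y] by blast
  note v = C1_rect_velocities[OF y]
  note bil = bounded_bilinear_matrix_mult
  have "U x t ** hat (lower (C x *v lower (yt x t))) + (U x t ** hat (lower (upper (y x t)))) ** hat (bending l C R y x t) =
      U x t ** hat (lower (upper (yx x t))) + (U x t ** hat (bending l C R y x t)) ** hat (lower (upper (y x t)))"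
    by (rule mixed_derivatives_eq[OF U C1_rect_bilinear[OF bil U C1_rect_linear[OF bounded_linear_hat k]]
          C1_rect_bilinear[OF bil U C1_rect_linear[OF bounded_linear_hat v(2)]] l_pos T_pos xt])
  then have "U x t ** (hat (lower (C x *v lower (yt x t))) + hat (lower (upper (y x t))) ** hat (bending l C R y x t)) =
      U x t ** (hat (lower (upper (yx x t))) + hat (bending l C R y x t) ** hat (lower (upper (y x t))))"
    by (simp add: bounded_bilinear.add_right[OF bil] matrix_mul_assoc)
  then have "hat (lower (C x *v lower (yt x t))) = hat (lower (upper (yx x t)) + cross3 (bending l C R y x t) (lower (upper (y x t))))"
    by (simp add: orthogonal_inj[OF orth] hat_add hat_cross algebra_simps)
  then show "lower (C x *v lower (yt x t)) = lower (upper (yx x t)) + cross3 (bending l C R y x t) (lower (upper (y x t)))"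
    by (simp add: hat_eq_iff)
  have "U x t *v (upper (C x *v lower (yt x t)) + cross3 (lower (upper (y x t))) (stretching C y x t)) =
      U x t *v (upper (upper (yx x t)) + cross3 (bending l C R y x t) (upper (upper (y x t))))"
    by (rule mixed_derivatives_eq[OF p C1_rect_rotated[OF U e] C1_rect_rotated[OF U v(1)] l_pos T_pos xt])
  then have "upper (C x *v lower (yt x t)) + cross3 (lower (upper (y x t))) (stretching C y x t) =
      upper (upper (yx x t)) + cross3 (bending l C R y x t) (upper (upper (y x t)))"
    by (simp only: orthogonal_inj[OF orth])
  then show "upper (C x *v lower (yt x t)) = upper (upper (yx x t)) +
      cross3 (bending l C R y x t) (upper (upper (y x t))) + cross3 (stretching C y x t) (lower (upper (y x t)))"
    by (simp add: cross_skew[of "stretching C y x t"] algebra_simps)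
qed

lemma moving_frame_transf:
  assumes mf: "moving_frame l T C R y p U" and xt: "x \<in> {0..l}" "t \<in> {0..T}"
  shows "velocity T p U x t = upper (y x t)" "stress l C R p U x t = lower (y x t)"
    "transf l T C R p U x t = y x t"
proof -
  note U = moving_frameD(1)[OF mf] and p = moving_frameD(2)[OF mf]
    and orth = moving_frameD(4)[OF mf xt]
  note D = C1_rect_Dx[OF U l_pos xt] C1_rect_Dt[OF U T_pos xt] C1_rect_Dx[OF p l_pos xt] C1_rect_Dt[OF p T_pos xt]
  show vel: "velocity T p U x t = upper (y x t)"
    by (simp add: velocity_def D orthogonal_cancel[OF orth] axial_hat del: transpose_matrix_vector)
  show str: "stress l C R p U x t = lower (y x t)"
    by (simp add: stress_def D orthogonal_cancel[OF orth] axial_hat stretching_def bending_def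
        matrix_inv_cancel[OF C_inv[OF xt(1)]] del: transpose_matrix_vector)
  show "transf l T C R p U x t = y x t"
    by (simp add: transf_def vel str)
qed

text \<open>Every term is \<open>U\<close> applied to a body-frame vector: derivatives by
  \<open>C1_rect_rotated\<close>, cross products because rotations commute with
  \<open>cross3\<close>, where determinant 1 is used. The factor \<open>U\<close> then
  cancels.\<close>

lemma momentum_balance_iff:
  assumes y: "C1_rect l T y yx yt" and mf: "moving_frame l T C R y p U"
    and xt: "x \<in> {0..l}" "t \<in> {0..T}"
  shows "momentum_balance l T M C R p U x t \<longleftrightarrow>
    upper (M x *v upper (yt x t)) + cross3 (lower (upper (y x t))) (upper (M x *v upper (y x t))) =
      upper (lower (yx x t)) + cross3 (bending l C R y x t) (upper (lower (y x t))) \<and>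
    lower (M x *v upper (yt x t)) + cross3 (lower (upper (y x t))) (lower (M x *v upper (y x t))) +
      cross3 (upper (upper (y x t))) (upper (M x *v upper (y x t))) =
      lower (lower (yx x t)) + cross3 (bending l C R y x t) (lower (lower (y x t))) +
      cross3 (stretching C y x t) (upper (lower (y x t)))"
proof -
  note U = moving_frameD(1)[OF mf] and p = moving_frameD(2)[OF mf]
    and rot = moving_frameD(3)[OF mf xt] and orth = moving_frameD(4)[OF mf xt]
  note vel = moving_frame_transf(1)[OF mf] and str = moving_frame_transf(2)[OF mf]
  have "\<exists>mx. C1_rect l T (\<lambda>x t. M x *v upper (y x t)) mx (\<lambda>x t. M x *v upper (yt x t))"
    by (rule exI, rule C1_rect_cong[OF C1_rect_bilinear[OF bounded_bilinear_matrix_vector_mult C1_rect_M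
            C1_rect_linear[OF bounded_linear_upper y]]]) simp_all
  then obtain mx where m: "C1_rect l T (\<lambda>x t. M x *v upper (y x t)) mx (\<lambda>x t. M x *v upper (yt x t))"
    by blast
  note m12 = C1_rect_rotated[OF U C1_rect_linear[OF bounded_linear_upper m]]
    C1_rect_rotated[OF U C1_rect_linear[OF bounded_linear_lower m]]
  note z = C1_rect_linear[OF bounded_linear_lower y]
  note z12 = C1_rect_rotated[OF U C1_rect_linear[OF bounded_linear_upper z]]
    C1_rect_rotated[OF U C1_rect_linear[OF bounded_linear_lower z]]
  \<comment> \<open>\<open>velocity\<close> and \<open>stress\<close> agree with the components of
    \<open>y\<close> on the rectangle only, so the derivatives are carried over by
    \<open>C1_rect_cong\<close>.\<close>
  note D = C1_rect_Dt[OF C1_rect_cong[OF m12(1)] T_pos xt] C1_rect_Dt[OF C1_rect_cong[OF m12(2)] T_pos xt]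
    C1_rect_Dx[OF C1_rect_cong[OF z12(1)] l_pos xt] C1_rect_Dx[OF C1_rect_cong[OF z12(2)] l_pos xt]
  have Da: "Dt T (\<lambda>x t. U x t *v upper (M x *v velocity T p U x t)) x t =
      U x t *v (upper (M x *v upper (yt x t)) + cross3 (lower (upper (y x t))) (upper (M x *v upper (y x t))))"
    by (rule D(1)) (simp_all add: vel)
  have Db: "Dt T (\<lambda>x t. U x t *v lower (M x *v velocity T p U x t)) x t =
      U x t *v (lower (M x *v upper (yt x t)) + cross3 (lower (upper (y x t))) (lower (M x *v upper (y x t))))"
    by (rule D(2)) (simp_all add: vel)
  have D\<phi>: "Dx l (\<lambda>x t. U x t *v upper (stress l C R p U x t)) x t =
      U x t *v (upper (lower (yx x t)) + cross3 (bending l C R y x t) (upper (lower (y x t))))"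
    by (rule D(3)) (simp_all add: str)
  have D\<psi>: "Dx l (\<lambda>x t. U x t *v lower (stress l C R p U x t)) x t =
      U x t *v (lower (lower (yx x t)) + cross3 (bending l C R y x t) (lower (lower (y x t))))"
    by (rule D(4)) (simp_all add: str)
  show ?thesis
    unfolding momentum_balance_def Let_def block_diag_mult upper_stack lower_stack Da Db D\<phi> D\<psi>
      C1_rect_Dx[OF p l_pos xt] C1_rect_Dt[OF p T_pos xt] vel[OF xt] str[OF xt] cross_rotation_matrix[OF rot]
      matrix_vector_right_distrib[symmetric] orthogonal_inj[OF orth]
    by (simp add: ac_simps)
qed

text \<open>Of the two halves in \<open>intrinsic_pde_iff\<close>, compatibility holds automatically
  for a moving frame, so the balance laws are all that remains.\<close>

lemma intrinsic_pde_iff_momentum_balance: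
  assumes y: "C1_rect l T y yx yt" and mf: "moving_frame l T C R y p U"
    and xt: "x \<in> {0..l}" "t \<in> {0..T}"
  shows "yt x t + Amat M C x *v yx x t + Bmat l M C R x *v y x t = gbar M C x (y x t) \<longleftrightarrow>
    momentum_balance l T M C R p U x t"
  unfolding momentum_balance_iff[OF assms] bending_def stretching_def
    intrinsic_pde_iff[where M = M and C = C and u = "y x t" and ut = "yt x t",
      OF M_inv[OF xt(1)] C_inv[OF xt(1)] refl refl refl refl refl refl]
  using moving_frame_compatible[OF assms, unfolded bending_def stretching_def] by simp

end

section \<open>The intrinsic and the geometrically exact problem\<close>

lemma bounded_bilinear_cross3: "bounded_bilinear cross3"
  using bilinear_cross bilinear_conv_bounded_bilinear by blast

locale beam_problem = beam l T M C R
  for l T :: real and M C :: "real \<Rightarrow> mat6" and R :: "real \<Rightarrow> real ^ 3 ^ 3" +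
  fixes K :: mat6 and fp :: "real ^ 3" and fR :: "real ^ 3 ^ 3"
    and p0 p1 w0 :: "real \<Rightarrow> real ^ 3" and R0 :: "real \<Rightarrow> real ^ 3 ^ 3"
  assumes p0_C1: "Ck_seg 1 l p0" and R0_C1: "Ck_seg 1 l R0"
    and R0_rot: "\<And>x. x \<in> {0..l} \<Longrightarrow> rotation_matrix (R0 x)"
    and fp: "fp = p0 0" and fR: "fR = R0 0"
begin

abbreviation intrinsic_solution :: "(real \<Rightarrow> real \<Rightarrow> real12) \<Rightarrow> bool" where
  "intrinsic_solution \<equiv> solves_IGEB l T M C R K (y_init l C R p0 R0 p1 w0)"

abbreviation beam_solution :: "(real \<Rightarrow> real \<Rightarrow> real ^ 3) \<Rightarrow> (real \<Rightarrow> real \<Rightarrow> real ^ 3 ^ 3) \<Rightarrow> bool" where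
  "beam_solution \<equiv> solves_GEB l T M C R K fp fR p0 R0 p1 w0"

section \<open>Properties of an intrinsic solution up to the boundary\<close>

lemma R0_orth: "x \<in> {0..l} \<Longrightarrow> orthogonal_matrix (R0 x)"
  using R0_rot by (simp add: rotation_matrix_def)

lemma intrinsic_solution_C1: "intrinsic_solution y \<Longrightarrow> C1_rect l T y (Dx l y) (Dt T y)"
  by (simp only: solves_IGEB_def Ck_rect_1_iff)

text \<open>\<open>y_init\<close> is built so that its strains at t = 0 are those of
  \<open>R0\<close> and \<open>p0\<close>. It is prescribed in the open interval, and continuity
  adds the end points. These are the starting conditions for \<open>flat_frame_exists\<close> and
  \<open>potential_exists\<close>.\<close>

lemma intrinsic_solution_initial:
  assumes sol: "intrinsic_solution y" and x: "x \<in> {0..l}"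
  shows "(R0 has_vector_derivative R0 x ** hat (bending l C R y x 0)) (at x within {0..l})"
    and "(p0 has_vector_derivative R0 x *v stretching C y x 0) (at x within {0..l})"
proof -
  note y = intrinsic_solution_C1[OF sol]
  have T0: "0 \<in> {0..T}" using T_pos by simp
  have init: "bending l C R y \<xi> 0 = axial (transpose (R0 \<xi>) ** Dseg l R0 \<xi>)"
    "stretching C y \<xi> 0 = transpose (R0 \<xi>) *v Dseg l p0 \<xi>" if \<xi>: "\<xi> \<in> {0<..<l}" for \<xi>
  proof -
    have "y \<xi> 0 = y_init l C R p0 R0 p1 w0 \<xi>" using sol \<xi> by (simp add: solves_IGEB_def)
    then show "bending l C R y \<xi> 0 = axial (transpose (R0 \<xi>) ** Dseg l R0 \<xi>)"
      "stretching C y \<xi> 0 = transpose (R0 \<xi>) *v Dseg l p0 \<xi>"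
      using C_inv[of \<xi>] \<xi> by (simp_all add: bending_def stretching_def y_init_def matrix_inv_cancel)
  qed
  have cont_R0: "continuous_on {0..l} (\<lambda>x. transpose (R0 x))"
    by (intro bounded_linear.continuous_on[OF bounded_linear_transpose] Ck_seg_1D[OF R0_C1])
  have "bending l C R y x 0 = axial (transpose (R0 x) ** Dseg l R0 x)"
  proof (rule continuous_on_eq_closed[OF _ _ l_pos init(1) x])
    show "continuous_on {0..l} (\<lambda>x. bending l C R y x 0)"
      using C1_rect_bending[OF y] cont_rect_slice_x[OF C1_rectD(1) T0] by blast
    show "continuous_on {0..l} (\<lambda>x. axial (transpose (R0 x) ** Dseg l R0 x))"
      by (intro bounded_linear.continuous_on[OF bounded_linear_axial] cont_R0
          bounded_bilinear.continuous_on[OF bounded_bilinear_matrix_mult] Ck_seg_1D[OF R0_C1])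
  qed
  then show "(R0 has_vector_derivative R0 x ** hat (bending l C R y x 0)) (at x within {0..l})"
    using Ck_seg_1D(3)[OF R0_C1 x] frame_derivative[OF Ck_seg_1D(3)[OF R0_C1 x] l_pos x R0_orth] by simp
  have "stretching C y x 0 = transpose (R0 x) *v Dseg l p0 x"
  proof (rule continuous_on_eq_closed[OF _ _ l_pos init(2) x])
    show "continuous_on {0..l} (\<lambda>x. stretching C y x 0)"
      using C1_rect_stretching[OF y] cont_rect_slice_x[OF C1_rectD(1) T0] by blast
    show "continuous_on {0..l} (\<lambda>x. transpose (R0 x) *v Dseg l p0 x)"
      by (intro cont_R0 bounded_bilinear.continuous_on[OF bounded_bilinear_matrix_vector_mult] Ck_seg_1D[OF p0_C1])
  qed
  then have "R0 x *v stretching C y x 0 = Dseg l p0 x"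
    by (simp only: orthogonal_cancel[OF R0_orth[OF x]])
  then show "(p0 has_vector_derivative R0 x *v stretching C y x 0) (at x within {0..l})"
    using Ck_seg_1D(3)[OF p0_C1 x] by simp
qed

text \<open>The second half of \<open>intrinsic_pde_iff\<close>, extended from the interior to the
  boundary. Here it comes from the equation itself, as no frame is available yet.\<close>

lemma intrinsic_solution_compatible:
  assumes sol: "intrinsic_solution y" and x: "x \<in> {0..l}" and t: "t \<in> {0..T}"
  shows "upper (C x *v lower (Dt T y x t)) = upper (upper (Dx l y x t)) +
      cross3 (bending l C R y x t) (upper (upper (y x t))) + cross3 (stretching C y x t) (lower (upper (y x t)))"
    and "lower (C x *v lower (Dt T y x t)) = lower (upper (Dx l y x t)) +
      cross3 (bending l C R y x t) (lower (upper (y x t)))"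
proof -
  note y = intrinsic_solution_C1[OF sol]
  have eq: "upper (C x *v lower (Dt T y x t)) = upper (upper (Dx l y x t)) +
      cross3 (bending l C R y x t) (upper (upper (y x t))) + cross3 (stretching C y x t) (lower (upper (y x t)))"
    "lower (C x *v lower (Dt T y x t)) = lower (upper (Dx l y x t)) +
      cross3 (bending l C R y x t) (lower (upper (y x t)))"
    if x: "x \<in> {0<..<l}" and t: "t \<in> {0<..<T}" for x t
  proof -
    have "x \<in> {0..l}" using x by simp
    moreover have "Dt T y x t + Amat M C x *v Dx l y x t + Bmat l M C R x *v y x t = gbar M C x (y x t)"
      using sol x t by (simp add: solves_IGEB_def)
    ultimately show "upper (C x *v lower (Dt T y x t)) = upper (upper (Dx l y x t)) +
        cross3 (bending l C R y x t) (upper (upper (y x t))) + cross3 (stretching C y x t) (lower (upper (y x t)))"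
      "lower (C x *v lower (Dt T y x t)) = lower (upper (Dx l y x t)) +
        cross3 (bending l C R y x t) (lower (upper (y x t)))"
      using intrinsic_pde_iff[where M = M and C = C and u = "y x t" and ut = "Dt T y x t",
          OF M_inv C_inv refl refl refl refl refl refl]
      unfolding bending_def stretching_def by blast+
  qed
  have k: "cont_rect l T (bending l C R y)" and e: "cont_rect l T (stretching C y)"
    using C1_rect_bending[OF y] C1_rect_stretching[OF y] C1_rectD(1) by blast+
  have ct: "cont_rect l T (\<lambda>x t. C x *v lower (Dt T y x t))"
    by (intro cont_rect_bilinear[OF bounded_bilinear_matrix_vector_mult] C1_rectD(1)[OF C1_rect_C]
        cont_rect_linear[OF bounded_linear_lower] C1_rectD(3)[OF y])
  note v = C1_rectD(1,2)[OF C1_rect_velocities(1)[OF y]] C1_rectD(1,2)[OF C1_rect_velocities(2)[OF y]]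
  show "upper (C x *v lower (Dt T y x t)) = upper (upper (Dx l y x t)) +
      cross3 (bending l C R y x t) (upper (upper (y x t))) + cross3 (stretching C y x t) (lower (upper (y x t)))"
    by (rule cont_rect_eq_closed[OF cont_rect_linear[OF bounded_linear_upper ct] _ l_pos T_pos eq(1) x t])
      (intro cont_rect_add cont_rect_bilinear[OF bounded_bilinear_cross3] k e v)
  show "lower (C x *v lower (Dt T y x t)) = lower (upper (Dx l y x t)) +
      cross3 (bending l C R y x t) (lower (upper (y x t)))"
    by (rule cont_rect_eq_closed[OF cont_rect_linear[OF bounded_linear_lower ct] _ l_pos T_pos eq(2) x t])
      (intro cont_rect_add cont_rect_bilinear[OF bounded_bilinear_cross3] k e v)
qed

section \<open>From an intrinsic solution to a beam motion\<close>

lemma moving_frame_exists: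
  assumes sol: "intrinsic_solution y"
  obtains p U where "moving_frame l T C R y p U"
    and "\<And>x. x \<in> {0..l} \<Longrightarrow> U x 0 = R0 x" and "\<And>x. x \<in> {0..l} \<Longrightarrow> p x 0 = p0 x"
proof -
  note y = intrinsic_solution_C1[OF sol]
  note v = C1_rect_velocities[OF y]
  note compat = intrinsic_solution_compatible[OF sol]
  obtain kx where k: "C1_rect l T (bending l C R y) kx (\<lambda>x t. lower (C x *v lower (Dt T y x t)))"
    using C1_rect_bending[OF y] by blast
  obtain ex where e: "C1_rect l T (stretching C y) ex (\<lambda>x t. upper (C x *v lower (Dt T y x t)))"
    using C1_rect_stretching[OF y] by blast
  obtain U where U: "C1_rect l T U (\<lambda>x t. U x t ** hat (bending l C R y x t)) (\<lambda>x t. U x t ** hat (lower (upper (y x t))))"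
    and U_init: "\<And>x. x \<in> {0..l} \<Longrightarrow> U x 0 = R0 x"
  proof (rule flat_frame_exists[OF C1_rect_linear[OF bounded_linear_hat v(2)] C1_rect_linear[OF bounded_linear_hat k]
        _ intrinsic_solution_initial(1)[OF sol]])
    \<comment> \<open>Zero curvature is the image under \<open>hat\<close> of the last three
      compatibility equations.\<close>
    show "hat (lower (C x *v lower (Dt T y x t))) - hat (lower (upper (Dx l y x t))) =
        hat (bending l C R y x t) ** hat (lower (upper (y x t))) -
        hat (lower (upper (y x t))) ** hat (bending l C R y x t)"
      if "x \<in> {0..l}" "t \<in> {0..T}" for x t
      by (simp add: compat(2)[OF that] hat_add hat_cross)
  qed (use l_pos T_pos in auto)
  obtain p where p: "C1_rect l T p (\<lambda>x t. U x t *v stretching C y x t) (\<lambda>x t. U x t *v upper (upper (y x t)))"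
    and p_init: "\<And>x. p x 0 = p0 x"
  proof (rule potential_exists[OF C1_rect_rotated[OF U e] C1_rect_rotated[OF U v(1)]])
    \<comment> \<open>Closedness of the form. The time derivative of \<open>U *v stretching\<close>
      contributes the angular velocity crossed with the stretching, which cancels the last cross
      product in \<open>compat(1)\<close> by antisymmetry.\<close>
    show "U x t *v (upper (C x *v lower (Dt T y x t)) + cross3 (lower (upper (y x t))) (stretching C y x t)) =
        U x t *v (upper (upper (Dx l y x t)) + cross3 (bending l C R y x t) (upper (upper (y x t))))"
      if "x \<in> {0..l}" "t \<in> {0..T}" for x t
      by (simp add: compat(1)[OF that] cross_skew[of "stretching C y x t"])
    show "(p0 has_vector_derivative U x 0 *v stretching C y x 0) (at x within {0..l})" if "x \<in> {0..l}" for x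
      using intrinsic_solution_initial(2)[OF sol that] U_init[OF that] by simp
  qed (use T_pos in auto)
  have "rotation_matrix (U x t)" if "x \<in> {0..l}" "t \<in> {0..T}" for x t
    using frame_rotation[OF C1_rectD(5)[OF U that(1)] _ that(2)] U_init[OF that(1)] R0_rot[OF that(1)] by simp
  then have "moving_frame l T C R y p U"
    using U p by (simp add: moving_frame_def)
  then show thesis
    using U_init p_init by (rule that)
qed

text \<open>The first derivatives of \<open>p\<close> and \<open>U\<close> are products of
  \<open>U\<close> with C^1 functions of \<open>y\<close>, so one order of regularity is gained over
  \<open>y\<close>.\<close>

lemma moving_frame_C2:
  assumes y: "C1_rect l T y yx yt" and mf: "moving_frame l T C R y p U"
  shows "Ck_rect 2 l T p" "Ck_rect 2 l T U"
proof -
  note U = moving_frameD(1)[OF mf] and p = moving_frameD(2)[OF mf]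
  note v = C1_rect_velocities[OF y]
  obtain kx kt where k: "C1_rect l T (bending l C R y) kx kt"
    using C1_rect_bending[OF y] by blast
  obtain ex et where e: "C1_rect l T (stretching C y) ex et"
    using C1_rect_stretching[OF y] by blast
  show "Ck_rect 2 l T p"
    by (rule Ck_rect_2I[OF p C1_rect_rotated[OF U e] C1_rect_rotated[OF U v(1)] l_pos T_pos])
  show "Ck_rect 2 l T U"
    by (rule Ck_rect_2I[OF U C1_rect_bilinear[OF bounded_bilinear_matrix_mult U C1_rect_linear[OF bounded_linear_hat k]]
          C1_rect_bilinear[OF bounded_bilinear_matrix_mult U C1_rect_linear[OF bounded_linear_hat v(2)]] l_pos T_pos])
qed

lemma intrinsic_solution_left_end:
  assumes sol: "intrinsic_solution y" and t: "t \<in> {0..T}"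
  shows "upper (y 0 t) = 0"
proof (rule continuous_on_eq_closed[OF _ _ T_pos _ t])
  show "continuous_on {0..T} (\<lambda>t. upper (y 0 t))"
    by (rule cont_rect_slice_t[OF cont_rect_linear[OF bounded_linear_upper C1_rectD(1)[OF intrinsic_solution_C1[OF sol]]]])
      (use l_pos in auto)
qed (use sol in \<open>auto simp: solves_IGEB_def\<close>)

text \<open>Vanishing linear and angular velocity at x = 0 freezes position and frame there;
  together with the compatibility of the data this yields the clamped condition.\<close>

lemma moving_frame_left_end:
  assumes sol: "intrinsic_solution y" and mf: "moving_frame l T C R y p U" and t: "t \<in> {0..T}"
  shows "U 0 t = U 0 0" "p 0 t = p 0 0"
proof -
  note U = moving_frameD(1)[OF mf] and p = moving_frameD(2)[OF mf]
  have l0: "0 \<in> {0..l}" and T0: "0 \<in> {0..T}" using l_pos T_pos by auto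
  have zero: "upper (upper (y 0 \<tau>)) = 0" "lower (upper (y 0 \<tau>)) = 0" if "\<tau> \<in> {0..T}" for \<tau>
    using intrinsic_solution_left_end[OF sol that] by (simp_all add: upper_def lower_def vec_eq_iff)
  have "((\<lambda>t. U 0 t) has_vector_derivative 0) (at \<tau> within {0..T})" if "\<tau> \<in> {0..T}" for \<tau>
    using C1_rectD(5)[OF U l0 that] zero[OF that] by (simp add: hat_zero)
  then obtain c where "\<And>\<tau>. \<tau> \<in> {0..T} \<Longrightarrow> U 0 \<tau> = c"
    by (rule has_vector_derivative_zero_constant[of "{0..T}", rotated]) simp_all
  then show "U 0 t = U 0 0" using t T0 by metis
  have "((\<lambda>t. p 0 t) has_vector_derivative 0) (at \<tau> within {0..T})" if "\<tau> \<in> {0..T}" for \<tau>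
    using C1_rectD(5)[OF p l0 that] zero[OF that] by simp
  then obtain c where "\<And>\<tau>. \<tau> \<in> {0..T} \<Longrightarrow> p 0 \<tau> = c"
    by (rule has_vector_derivative_zero_constant[of "{0..T}", rotated]) simp_all
  then show "p 0 t = p 0 0" using t T0 by metis
qed

lemma moving_frame_solves:
  assumes sol: "intrinsic_solution y" and mf: "moving_frame l T C R y p U"
    and U_init: "\<And>x. x \<in> {0..l} \<Longrightarrow> U x 0 = R0 x" and p_init: "\<And>x. x \<in> {0..l} \<Longrightarrow> p x 0 = p0 x"
  shows "beam_solution p U"
proof -
  note y = intrinsic_solution_C1[OF sol]
  note U = moving_frameD(1)[OF mf] and p = moving_frameD(2)[OF mf]
  have l0: "0 \<in> {0..l}" "l \<in> {0..l}" and T0: "0 \<in> {0..T}" using l_pos T_pos by auto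
  note transf = moving_frame_transf(1,2)[OF mf]
  have balance: "momentum_balance l T M C R p U x t" if x: "x \<in> {0<..<l}" and t: "t \<in> {0<..<T}" for x t
  proof -
    have "Dt T y x t + Amat M C x *v Dx l y x t + Bmat l M C R x *v y x t = gbar M C x (y x t)"
      using sol x t by (simp add: solves_IGEB_def)
    then show ?thesis
      using intrinsic_pde_iff_momentum_balance[OF y mf, of x t] x t by simp
  qed
  have right: "block_diag (U l t) (U l t) *v stress l C R p U l t =
      - (block_diag (U l t) (U l t) *v (K *v velocity T p U l t))" if t: "t \<in> {0<..<T}" for t
  proof -
    have "lower (y l t) = - (K *v upper (y l t))" using sol t by (simp add: solves_IGEB_def)
    then show ?thesis
      using t l0 by (simp add: transf bounded_bilinear.minus_right[OF bounded_bilinear_matrix_vector_mult])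
  qed
  have init: "Dt T p x 0 = p1 x" "U x 0 *v axial (transpose (U x 0) ** Dt T U x 0) = w0 x"
    if x: "x \<in> {0<..<l}" for x
  proof -
    have x': "x \<in> {0..l}" using x by simp
    have yx: "y x 0 = y_init l C R p0 R0 p1 w0 x" using sol x by (simp add: solves_IGEB_def)
    show "Dt T p x 0 = p1 x"
      unfolding C1_rect_Dt[OF p T_pos x' T0] U_init[OF x'] yx y_init_def upper_stack
      by (rule orthogonal_cancel[OF R0_orth[OF x']])
    show "U x 0 *v axial (transpose (U x 0) ** Dt T U x 0) = w0 x"
      by (simp only: C1_rect_Dt[OF U T_pos x' T0] U_init[OF x'] yx y_init_def upper_stack lower_stack
          orthogonal_cancel[OF R0_orth[OF x']] axial_hat)
  qed
  show ?thesis
    unfolding solves_GEB_def Let_def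
    using moving_frame_C2[OF y mf] moving_frameD(3)[OF mf] balance right init
      moving_frame_left_end[OF sol mf] U_init p_init l0 fp fR
    by (auto simp: momentum_balance_def Let_def)
qed

section \<open>From a beam motion to an intrinsic solution\<close>

lemma beam_solution_initial:
  assumes sol: "beam_solution p U" and x: "x \<in> {0..l}"
  shows "p x 0 = p0 x" "U x 0 = R0 x"
proof -
  have T0: "0 \<in> {0..T}" using T_pos by simp
  have "Ck_rect 2 l T p" "Ck_rect 2 l T U"
    using sol by (simp_all add: solves_GEB_def Let_def)
  then have c: "cont_rect l T p" "cont_rect l T U"
    unfolding Ck_rect_2_iff using C1_rectD(1) by blast+
  show "p x 0 = p0 x"
    by (rule continuous_on_eq_closed[OF cont_rect_slice_x[OF c(1) T0] Ck_seg_1D(1)[OF p0_C1] l_pos _ x])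
      (use sol in \<open>auto simp: solves_GEB_def Let_def\<close>)
  show "U x 0 = R0 x"
    by (rule continuous_on_eq_closed[OF cont_rect_slice_x[OF c(2) T0] Ck_seg_1D(1)[OF R0_C1] l_pos _ x])
      (use sol in \<open>auto simp: solves_GEB_def Let_def\<close>)
qed

lemma beam_solution_C1:
  assumes sol: "beam_solution p U"
  shows "C1_rect l T p (Dx l p) (Dt T p)" "C1_rect l T U (Dx l U) (Dt T U)"
    "Ck_rect 1 l T (transf l T C R p U)"
proof -
  have C2: "Ck_rect 2 l T p" "Ck_rect 2 l T U"
    using sol by (simp_all add: solves_GEB_def Let_def)
  then show p: "C1_rect l T p (Dx l p) (Dt T p)" and U: "C1_rect l T U (Dx l U) (Dt T U)"
    unfolding Ck_rect_2_iff by blast+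
  obtain pxx pxt ptx ptt Uxx Uxt Utx Utt where
    d: "C1_rect l T (Dx l p) pxx pxt" "C1_rect l T (Dt T p) ptx ptt"
      "C1_rect l T (Dx l U) Uxx Uxt" "C1_rect l T (Dt T U) Utx Utt"
    using C2 unfolding Ck_rect_2_iff Ck_rect_1_iff by blast
  obtain R' where c: "C1_rect l T (\<lambda>x t. curvature l R x) R' (\<lambda>x t. 0)"
    using C1_rect_curvature by blast
  note Ut = C1_rect_linear[OF bounded_linear_transpose U]
  note rv = C1_rect_bilinear[OF bounded_bilinear_matrix_vector_mult Ut]
  note rm = C1_rect_linear[OF bounded_linear_axial C1_rect_bilinear[OF bounded_bilinear_matrix_mult Ut]]
  note v = C1_rect_stack[OF rv[OF d(2)] rm[OF d(4)]]
  note z = C1_rect_bilinear[OF bounded_bilinear_matrix_vector_mult C1_rect_C_inv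
      C1_rect_stack[OF C1_rect_diff[OF rv[OF d(1)] C1_rect_const] C1_rect_diff[OF rm[OF d(3)] c]]]
  show "Ck_rect 1 l T (transf l T C R p U)"
    unfolding transf_def[abs_def] velocity_def stress_def
    by (rule Ck_rect_1I[OF C1_rect_stack[OF v z] l_pos T_pos])
qed

text \<open>Since \<open>U\<close> takes values in SO(3), \<open>frame_derivative\<close> recovers
  both of its derivatives from their axial vectors; multiplication by \<open>C\<close> recovers the
  strains from the stress.\<close>

lemma beam_solution_moving_frame:
  assumes sol: "beam_solution p U"
  shows "moving_frame l T C R (transf l T C R p U) p U"
proof -
  let ?y = "transf l T C R p U"
  note p = beam_solution_C1(1)[OF sol] and U = beam_solution_C1(2)[OF sol]
  have rot: "rotation_matrix (U x t)" if "x \<in> {0..l}" "t \<in> {0..T}" for x t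
    using sol that by (simp add: solves_GEB_def Let_def)
  then have orth: "orthogonal_matrix (U x t)" if "x \<in> {0..l}" "t \<in> {0..T}" for x t
    using that by (simp add: rotation_matrix_def)
  have strains: "bending l C R ?y x t = axial (transpose (U x t) ** Dx l U x t)"
    "stretching C ?y x t = transpose (U x t) *v Dx l p x t" if "x \<in> {0..l}" for x t
    by (simp_all add: bending_def stretching_def transf_def stress_def matrix_inv_cancel[OF C_inv[OF that]])
  have "C1_rect l T U (\<lambda>x t. U x t ** hat (bending l C R ?y x t)) (\<lambda>x t. U x t ** hat (lower (upper (?y x t))))"
  proof (rule C1_rect_cong[OF U])
    fix x t assume x: "x \<in> {0..l}" and t: "t \<in> {0..T}"
    show "U x t ** hat (bending l C R ?y x t) = Dx l U x t"
      unfolding strains[OF x]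
      using frame_derivative[OF C1_rectD(4)[OF U x t] l_pos x] orth t by simp
    show "U x t ** hat (lower (upper (?y x t))) = Dt T U x t"
      using frame_derivative[OF C1_rectD(5)[OF U x t] T_pos t] orth x
      by (simp add: transf_def velocity_def)
  qed simp
  moreover have "C1_rect l T p (\<lambda>x t. U x t *v stretching C ?y x t) (\<lambda>x t. U x t *v upper (upper (?y x t)))"
    by (rule C1_rect_cong[OF p])
      (simp_all add: strains orthogonal_cancel[OF orth] transf_def velocity_def del: transpose_matrix_vector)
  ultimately show ?thesis
    using rot by (simp add: moving_frame_def)
qed

lemma beam_solution_intrinsic:
  assumes sol: "beam_solution p U"
  shows "intrinsic_solution (transf l T C R p U)"
proof -
  let ?y = "transf l T C R p U"
  note p = beam_solution_C1(1)[OF sol] and U = beam_solution_C1(2)[OF sol]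
  note mf = beam_solution_moving_frame[OF sol]
  note y = beam_solution_C1(3)[OF sol, unfolded Ck_rect_1_iff]
  note orth = moving_frameD(4)[OF mf]
  note init = beam_solution_initial[OF sol]
  have l0: "0 \<in> {0..l}" "l \<in> {0..l}" and T0: "0 \<in> {0..T}" using l_pos T_pos by auto
  have pde: "Dt T ?y x t + Amat M C x *v Dx l ?y x t + Bmat l M C R x *v ?y x t = gbar M C x (?y x t)"
    if x: "x \<in> {0<..<l}" and t: "t \<in> {0<..<T}" for x t
  proof -
    have "momentum_balance l T M C R p U x t"
      using sol x t by (simp add: solves_GEB_def momentum_balance_def Let_def)
    then show ?thesis
      using intrinsic_pde_iff_momentum_balance[OF y mf, of x t] x t by simp
  qed
  have left: "upper (?y 0 t) = 0" if t: "t \<in> {0<..<T}" for t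
  proof -
    have t': "t \<in> {0..T}" using t by simp
    \<comment> \<open>Constancy is extended to the closed time interval, because \<open>Dt\<close>
      is a derivative within \<open>{0..T}\<close> and functions are compared on all of it.\<close>
    have "p 0 \<tau> = fp" "U 0 \<tau> = fR" if \<tau>: "\<tau> \<in> {0..T}" for \<tau>
      by (rule continuous_on_eq_closed[OF cont_rect_slice_t[OF C1_rectD(1)[OF p] l0(1)] continuous_on_const T_pos _ \<tau>]
          continuous_on_eq_closed[OF cont_rect_slice_t[OF C1_rectD(1)[OF U] l0(1)] continuous_on_const T_pos _ \<tau>],
          use sol in \<open>auto simp: solves_GEB_def Let_def\<close>)+
    then have "((\<lambda>\<tau>. p 0 \<tau>) has_vector_derivative 0) (at t within {0..T})"
      "((\<lambda>\<tau>. U 0 \<tau>) has_vector_derivative 0) (at t within {0..T})"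
      using has_vector_derivative_transform[OF t' _ has_vector_derivative_const] by blast+
    then have "Dt T p 0 t = 0" "Dt T U 0 t = 0"
      using Dt_eq[OF T_pos t'] by blast+
    then show ?thesis
      by (simp add: transf_def velocity_def linear_0[OF bounded_linear.linear[OF bounded_linear_axial]] stack_zero)
  qed
  have right: "lower (?y l t) = - (K *v upper (?y l t))" if t: "t \<in> {0<..<T}" for t
  proof -
    have t': "t \<in> {0..T}" using t by simp
    have "block_diag (U l t) (U l t) *v stress l C R p U l t =
        - (block_diag (U l t) (U l t) *v (K *v velocity T p U l t))"
      using sol t by (simp add: solves_GEB_def Let_def)
    then have "block_diag (U l t) (U l t) *v (stress l C R p U l t + K *v velocity T p U l t) = 0"
      by (simp add: matrix_vector_right_distrib)
    moreover have "invertible (U l t)"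
      using orth[OF l0(2) t'] unfolding orthogonal_matrix_def invertible_def by blast
    then have "invertible (block_diag (U l t) (U l t))"
      by (intro invertible_block_diag)
    ultimately have "stress l C R p U l t + K *v velocity T p U l t = 0"
      unfolding invertible_iff_ker by blast
    then show ?thesis
      by (simp add: transf_def eq_neg_iff_add_eq_0)
  qed
  have start: "?y x 0 = y_init l C R p0 R0 p1 w0 x" if x: "x \<in> {0<..<l}" for x
  proof -
    have x': "x \<in> {0..l}" using x by simp
    have "((\<lambda>\<xi>. p \<xi> 0) has_vector_derivative Dseg l p0 x) (at x within {0..l})"
      by (rule has_vector_derivative_transform[OF x' _ Ck_seg_1D(3)[OF p0_C1 x']]) (simp add: init)
    then have px: "Dx l p x 0 = Dseg l p0 x" by (rule Dx_eq[OF l_pos x'])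
    have "((\<lambda>\<xi>. U \<xi> 0) has_vector_derivative Dseg l R0 x) (at x within {0..l})"
      by (rule has_vector_derivative_transform[OF x' _ Ck_seg_1D(3)[OF R0_C1 x']]) (simp add: init)
    then have Ux: "Dx l U x 0 = Dseg l R0 x" by (rule Dx_eq[OF l_pos x'])
    have pt: "Dt T p x 0 = p1 x" and W: "U x 0 *v axial (transpose (U x 0) ** Dt T U x 0) = w0 x"
      using sol x unfolding solves_GEB_def Let_def by blast+
    have "axial (transpose (U x 0) ** Dt T U x 0) = transpose (U x 0) *v w0 x"
      unfolding W[symmetric] by (rule orthogonal_cancel(1)[OF orth[OF x' T0], symmetric])
    then show ?thesis
      by (simp add: transf_def velocity_def stress_def y_init_def px Ux pt init[OF x'] del: transpose_matrix_vector)
  qed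
  show ?thesis
    unfolding solves_IGEB_def using beam_solution_C1(3)[OF sol] pde left right start by blast
qed

end

theorem theorem3p3p4:
  fixes l T :: real
    and M C :: "real \<Rightarrow> mat6" and K :: mat6
    and R :: "real \<Rightarrow> real ^ 3 ^ 3"
    and p0 p1 w0 :: "real \<Rightarrow> real ^ 3" and R0 :: "real \<Rightarrow> real ^ 3 ^ 3"
    and fp :: "real ^ 3" and fR :: "real ^ 3 ^ 3"
    and y :: "real \<Rightarrow> real \<Rightarrow> real12"
  assumes "0 < l" and "0 < T"
    and "Ck_seg 1 l M" and "\<And>x. x \<in> {0..l} \<Longrightarrow> sym_pos_def (M x)"
    and "Ck_seg 1 l C" and "\<And>x. x \<in> {0..l} \<Longrightarrow> sym_pos_def (C x)"
    and "sym_pos_def K \<or> K = 0"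
    and "Ck_seg 2 l R" and "\<And>x. x \<in> {0..l} \<Longrightarrow> rotation_matrix (R x)"
    and "Ck_seg 2 l p0"
    and "Ck_seg 2 l R0" and "\<And>x. x \<in> {0..l} \<Longrightarrow> rotation_matrix (R0 x)"
    and "Ck_seg 1 l p1" and "Ck_seg 1 l w0"
    and "rotation_matrix fR"
    and "fp = p0 0" and "fR = R0 0"
    and "solves_IGEB l T M C R K (y_init l C R p0 R0 p1 w0) y"
    and "\<And>y'. solves_IGEB l T M C R K (y_init l C R p0 R0 p1 w0) y' \<Longrightarrow>
           \<forall>x\<in>{0..l}. \<forall>t\<in>{0..T}. y' x t = y x t"
  shows "\<exists>p Rot. solves_GEB l T M C R K fp fR p0 R0 p1 w0 p Rot \<and>
           (\<forall>p' Rot'. solves_GEB l T M C R K fp fR p0 R0 p1 w0 p' Rot' \<longrightarrow>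
              (\<forall>x\<in>{0..l}. \<forall>t\<in>{0..T}. p' x t = p x t \<and> Rot' x t = Rot x t)) \<and>
           (\<forall>x\<in>{0..l}. \<forall>t\<in>{0..T}. y x t = transf l T C R p Rot x t)"
proof -
  interpret beam_problem l T M C R K fp fR p0 p1 w0 R0
    by unfold_locales (use assms Ck_seg_2D(1) sym_pos_def_invertible in blast)+
  obtain p U where mf: "moving_frame l T C R y p U"
    and U_init: "\<And>x. x \<in> {0..l} \<Longrightarrow> U x 0 = R0 x" and p_init: "\<And>x. x \<in> {0..l} \<Longrightarrow> p x 0 = p0 x"
    using moving_frame_exists[OF assms(18)] by blast
  show ?thesis
  proof (intro exI conjI allI impI ballI)
    show "beam_solution p U"
      by (rule moving_frame_solves[OF assms(18) mf U_init p_init])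
    show "y x t = transf l T C R p U x t" if "x \<in> {0..l}" "t \<in> {0..T}" for x t
      using moving_frame_transf(3)[OF mf that] by simp
    fix p' U' x t
    assume sol: "beam_solution p' U'" and x: "x \<in> {0..l}" and t: "t \<in> {0..T}"
    have "\<forall>x\<in>{0..l}. \<forall>t\<in>{0..T}. transf l T C R p' U' x t = y x t"
      by (rule assms(19)[OF beam_solution_intrinsic[OF sol]])
    then have mf': "moving_frame l T C R y p' U'"
      by (intro moving_frame_cong[OF beam_solution_moving_frame[OF sol]]) simp
    have init: "U' x 0 = U x 0" "p' x 0 = p x 0"
      using beam_solution_initial[OF sol x] U_init[OF x] p_init[OF x] by simp_all
    show "p' x t = p x t" "U' x t = U x t"
      by (rule moving_frame_unique[OF mf mf' init x t])+
  qed
qed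

end
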